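(* Let $m\ge 1$, let $\beta_1,\beta_2,\dots,\beta_m$ be positive reals, and let $\nu$ be an infinitely divisible probability measure on $\mathbb{R}^d$. Then $$\mathcal{J}^{\{\beta_1,\dots,\beta_m\}}(\nu)=\mathcal{L}\Big(\int_{(0,1]} t\,dY_{\nu}\big(r_{\{\beta_1,\dots,\beta_m\}}(t)\big)\Big),$$ where the time change $r_{\{\beta_1,\dots,\beta_m\}}$ is given by $$r_{\{\beta_1,\dots,\beta_m\}}(t)=\mathbb{P}\big[\,U_1^{1/\beta_1}\cdot U_2^{1/\beta_2}\cdots U_m^{1/\beta_m}\le t\,\big],\qquad 0<t\le 1,$$ with $U_1,\dots,U_m$ mutually independent random variables uniformly distributed on the unit interval. Moreover: (i) If $n\ge 1$ and the positive reals $\beta_1,\dots,\beta_n$ are pairwise different, then for $0<t\le 1$ $$r_{\{\beta_1,\dots,\beta_n\}}(t)=\sum_{j=1}^n C_{j,n}\,t^{\beta_j},\qquad C_{j,n}:=\prod_{k=1,\,k\ne j}^n\frac{\beta_k}{\beta_k-\beta_j},$$ and, in particular, $\sum_{j=1}^n C_{j,n}=1$. (ii) If $\beta_1=\beta_2=\dots=\beta_m=\alpha>0$ ($m\ge1$), then $$r_{\{\underbrace{\alpha,\dots,\alpha}_{m\text{ times}}\}}(t)=t^{\alpha}\sum_{j=0}^{m-1}\frac{(-\alpha\log t)^j}{j!},\qquad 0<t\le 1.$$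
   Context: $\mathcal{L}(X)$ denotes the probability distribution of a random vector $X$ in $\mathbb{R}^d$. For an infinitely divisible probability measure $\nu$ on $\mathbb{R}^d$, $(Y_\nu(t))_{t\ge0}$ denotes an $\mathbb{R}^d$-valued Lévy process (stationary independent increments, $Y_\nu(0)=0$, cadlag paths) with $\mathcal{L}(Y_\nu(1))=\nu$. Random integrals are defined pathwise by formal integration by parts: for a bounded interval $(a,b]\subset[0,\infty)$, a continuous real function $h$ of bounded variation and a monotone function $r\ge 0$, $$\int_{(a,b]}h(t)\,dY_\nu(r(t)):=h(b)Y_\nu(r(b))-h(a)Y_\nu(r(a))-\int_{(a,b]}Y_\nu(r(t))\,dh(t).$$ The time changes $r$ considered here are extended by $r(0)=0$. For $\beta>0$ and $\nu$ infinitely divisible put $$\mathcal{J}^{\{\beta\}}(\nu)\equiv\mathcal{J}^{\beta}(\nu):=\mathcal{L}\Big(\int_{(0,1]}t^{1/\beta}\,dY_\nu(t)\Big)=\mathcal{L}\Big(\int_{(0,1]}t\,dY_\nu(t^{\beta})\Big),$$ which is again an infinitely divisible measure, and define compositions recursively: for $m\ge2$ and $\beta_1,\dots,\beta_m>0$, $$\mathcal{J}^{\{\beta_1,\dots,\beta_m\}}(\nu):=\mathcal{J}^{\beta_m}\big(\mathcal{J}^{\{\beta_1,\dots,\beta_{m-1}\}}(\nu)\big).$$ Empty products equal $1$, and $0^0=1$. *)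

theory Defs
  imports "HOL-Probability.Probability"
begin

section \<open>Infinite divisibility and Levy processes\<close>

text \<open>For every \<open>n \<ge> 1\<close>, \<open>\<nu>\<close> is the law of a sum of \<open>n\<close> i.i.d. vectors, i.e. an \<open>n\<close>-fold
  convolution power. (The library's \<open>convolution\<close> is restricted to ordered Euclidean spaces.)\<close>

definition infinitely_divisible :: "'a::euclidean_space measure \<Rightarrow> bool" where
  "infinitely_divisible \<nu> \<longleftrightarrow>
     prob_space \<nu> \<and> sets \<nu> = sets borel \<and>
     (\<forall>n::nat. n \<ge> 1 \<longrightarrow> (\<exists>\<rho> :: 'a measure. prob_space \<rho> \<and> sets \<rho> = sets borel \<and>
        \<nu> = distr (\<Pi>\<^sub>M i\<in>{..<n}. \<rho>) borel (\<lambda>x. \<Sum>i<n. x i)))"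

definition cadlag :: "(real \<Rightarrow> 'a::euclidean_space) \<Rightarrow> bool" where
  "cadlag y \<longleftrightarrow>
     (\<forall>t\<ge>0. continuous (at_right t) y) \<and> (\<forall>t>0. \<exists>l. (y \<longlongrightarrow> l) (at_left t))"

text \<open>Only the values at times \<open>t \<ge> 0\<close> matter. Both \<open>Y 0 = 0\<close> and the path regularity hold for
  every point of the sample space.\<close>

definition levy_process :: "'w measure \<Rightarrow> (real \<Rightarrow> 'w \<Rightarrow> 'a::euclidean_space) \<Rightarrow> bool" where
  "levy_process M Y \<longleftrightarrow>
     prob_space M \<and>
     (\<forall>t\<ge>0. Y t \<in> borel_measurable M) \<and>
     (\<forall>\<omega>\<in>space M. Y 0 \<omega> = 0) \<and>
     (\<forall>(n::nat) t. (\<forall>i\<le>n. 0 \<le> t i) \<and> (\<forall>i<n. t i \<le> t (Suc i)) \<longrightarrow>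
        prob_space.indep_vars M (\<lambda>_. borel) (\<lambda>i \<omega>. Y (t (Suc i)) \<omega> - Y (t i) \<omega>) {..<n}) \<and>
     (\<forall>s\<ge>0. \<forall>t\<ge>0. distr M borel (\<lambda>\<omega>. Y (s + t) \<omega> - Y s \<omega>) = distr M borel (Y t)) \<and>
     (\<forall>\<omega>\<in>space M. cadlag (\<lambda>t. Y t \<omega>))"

text \<open>A choice of the processes \<open>Y\<^sub>\<nu>\<close>: for each infinitely divisible law \<open>\<nu>\<close>, a Levy process \<open>Y \<nu>\<close>
  on a probability space \<open>P \<nu>\<close> whose value at time 1 has law \<open>\<nu>\<close>.\<close>

definition levy_family ::
  "('a::euclidean_space measure \<Rightarrow> 'w measure) \<Rightarrow> ('a measure \<Rightarrow> real \<Rightarrow> 'w \<Rightarrow> 'a) \<Rightarrow> bool" where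
  "levy_family P Y \<longleftrightarrow>
     (\<forall>\<nu>. infinitely_divisible \<nu> \<longrightarrow>
        levy_process (P \<nu>) (Y \<nu>) \<and> distr (P \<nu>) borel (Y \<nu> 1) = \<nu>)"


section \<open>Pathwise random integrals\<close>

text \<open>The integral of \<open>f\<close> with respect to \<open>dh\<close> over \<open>[a,b]\<close>: the library's gauge integral with the
  length of a cell \<open>K\<close> replaced by the increment of \<open>h\<close> over \<open>K\<close>. For continuous \<open>h\<close> of bounded
  variation and \<open>f\<close> with one-sided limits it is the Riemann-Stieltjes, equivalently the
  Lebesgue-Stieltjes, integral, and integrating over \<open>[a,b]\<close> or \<open>(a,b]\<close> makes no difference.\<close>

definition has_stieltjes_integral ::
  "(real \<Rightarrow> 'a::euclidean_space) \<Rightarrow> (real \<Rightarrow> real) \<Rightarrow> real \<Rightarrow> real \<Rightarrow> 'a \<Rightarrow> bool" where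
  "has_stieltjes_integral f h a b I \<longleftrightarrow>
     ((\<lambda>p. \<Sum>(x, K)\<in>p. (h (Sup K) - h (Inf K)) *\<^sub>R f x) \<longlongrightarrow> I) (division_filter {a..b})"

definition stieltjes_integral ::
  "(real \<Rightarrow> 'a::euclidean_space) \<Rightarrow> (real \<Rightarrow> real) \<Rightarrow> real \<Rightarrow> real \<Rightarrow> 'a" where
  "stieltjes_integral f h a b = (THE I. has_stieltjes_integral f h a b I)"

lemma has_stieltjes_integral_unique:
  assumes "has_stieltjes_integral f h a b I" "has_stieltjes_integral f h a b J"
  shows "I = J"
  using assms division_filter_not_empty[of a b] tendsto_unique
  unfolding has_stieltjes_integral_def box_real by blast

lemma has_stieltjes_integral_ident_iff:
  "has_stieltjes_integral f (\<lambda>t. t) a b I \<longleftrightarrow> (f has_integral I) {a..b}"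
proof -
  have eq: "(\<Sum>(x, K)\<in>p. (Sup K - Inf K) *\<^sub>R f x) = (\<Sum>(x, K)\<in>p. measure lborel K *\<^sub>R f x)"
    if p: "p tagged_division_of {a..b}" for p
  proof (rule sum.cong[OF refl], clarify)
    fix x K assume "(x, K) \<in> p"
    with p obtain u v where "K = {u..v}" "x \<in> K"
      by (metis tagged_division_ofD(2,4) box_real(2))
    then show "(Sup K - Inf K) *\<^sub>R f x = measure lborel K *\<^sub>R f x" by auto
  qed
  have "\<forall>\<^sub>F p in division_filter {a..b}.
      (\<Sum>(x, K)\<in>p. (Sup K - Inf K) *\<^sub>R f x) = (\<Sum>(x, K)\<in>p. measure lborel K *\<^sub>R f x)"
    by (rule eventually_mono[OF eventually_division_filter_tagged_division eq])
  then show ?thesis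
    unfolding has_stieltjes_integral_def
    using has_integral_cbox[of f I a b] tendsto_cong by (auto simp: box_real)
qed

text \<open>Formal integration by parts for the integral of \<open>h\<close> against \<open>d y(r(t))\<close> over \<open>(a,b]\<close>,
  for a single path \<open>y\<close>.\<close>

definition path_integral ::
  "real \<Rightarrow> real \<Rightarrow> (real \<Rightarrow> real) \<Rightarrow> (real \<Rightarrow> real) \<Rightarrow> (real \<Rightarrow> 'a::euclidean_space) \<Rightarrow> 'a" where
  "path_integral a b h r y =
     h b *\<^sub>R y (r b) - h a *\<^sub>R y (r a) - stieltjes_integral (\<lambda>t. y (r t)) h a b"

definition random_integral_law ::
  "real \<Rightarrow> real \<Rightarrow> (real \<Rightarrow> real) \<Rightarrow> (real \<Rightarrow> real) \<Rightarrow>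
   'w measure \<Rightarrow> (real \<Rightarrow> 'w \<Rightarrow> 'a::euclidean_space) \<Rightarrow> 'a measure" where
  "random_integral_law a b h r M Y =
     distr M borel (\<lambda>\<omega>. path_integral a b h r (\<lambda>t. Y t \<omega>))"


section \<open>The mappings and their compositions\<close>

text \<open>Note that \<open>0 powr (1 / \<beta>) = 0\<close>.\<close>

definition J_map ::
  "('a::euclidean_space measure \<Rightarrow> 'w measure) \<Rightarrow> ('a measure \<Rightarrow> real \<Rightarrow> 'w \<Rightarrow> 'a) \<Rightarrow>
   real \<Rightarrow> 'a measure \<Rightarrow> 'a measure" where
  "J_map P Y \<beta> \<nu> = random_integral_law 0 1 (\<lambda>t. t powr (1 / \<beta>)) (\<lambda>t. t) (P \<nu>) (Y \<nu>)"

text \<open>\<open>J_comp P Y \<beta> m\<close> is the mapping for \<open>\<beta> 1, \<dots>, \<beta> m\<close>, with \<open>\<beta> 1\<close> applied first.\<close>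

primrec J_comp ::
  "('a::euclidean_space measure \<Rightarrow> 'w measure) \<Rightarrow> ('a measure \<Rightarrow> real \<Rightarrow> 'w \<Rightarrow> 'a) \<Rightarrow>
   (nat \<Rightarrow> real) \<Rightarrow> nat \<Rightarrow> 'a measure \<Rightarrow> 'a measure" where
  "J_comp P Y \<beta> 0 \<nu> = \<nu>"
| "J_comp P Y \<beta> (Suc m) \<nu> = J_map P Y (\<beta> (Suc m)) (J_comp P Y \<beta> m \<nu>)"


section \<open>The time change\<close>

definition indep_uniforms :: "'u measure \<Rightarrow> (nat \<Rightarrow> 'u \<Rightarrow> real) \<Rightarrow> nat \<Rightarrow> bool" where
  "indep_uniforms N U m \<longleftrightarrow>
     prob_space N \<and> prob_space.indep_vars N (\<lambda>_. borel) U {1..m} \<and>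
     (\<forall>i\<in>{1..m}. distr N borel (U i) = uniform_measure lborel {0..1})"

definition time_change ::
  "'u measure \<Rightarrow> (nat \<Rightarrow> 'u \<Rightarrow> real) \<Rightarrow> (nat \<Rightarrow> real) \<Rightarrow> nat \<Rightarrow> real \<Rightarrow> real" where
  "time_change N U \<beta> m t =
     (if t = 0 then 0
      else measure N {\<omega> \<in> space N. (\<Prod>i=1..m. U i \<omega> powr (1 / \<beta> i)) \<le> t})"

definition coeff_C :: "(nat \<Rightarrow> real) \<Rightarrow> nat \<Rightarrow> nat \<Rightarrow> real" where
  "coeff_C \<beta> j n = (\<Prod>k\<in>{1..n} - {j}. \<beta> k / (\<beta> k - \<beta> j))"

end

theory Submission
  imports Defs
begin

text \<open>
  Laws on \<open>\<real>\<^sup>d\<close> are compared through their characteristic functions. For a Levy process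
  \<open>Y\<close> one has \<open>E exp(i u \<bullet> Y t) = exp(t \<psi>(u))\<close> with a continuous exponent \<open>\<psi>\<close> vanishing
  at 0 (\<open>levy_process_exponent\<close>). Such an exponent is determined by the law of \<open>Y 1\<close>, because two of
  them differ by a continuous function with values in \<open>2\<pi>i\<int>\<close>, and it determines that law
  (\<open>has_exponent_unique\<close>, \<open>has_exponent_determines\<close>).

  Let \<open>V\<close> be a random variable in \<open>(0,1]\<close> and let \<open>r\<close> be \<open>c\<close> times its distribution function.
  Summation by parts turns the pathwise integral of \<open>t dY(r(t))\<close> into a limit of the sums of
  \<open>(i/n) (Y(r((i+1)/n)) - Y(r(i/n)))\<close>. The increments are independent, so the exponents
  \<open>(r((i+1)/n) - r(i/n)) \<psi>((i/n) u)\<close> add up, and in the limit the integral has exponent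
  \<open>c E \<psi>(V u)\<close> (\<open>random_integral_exponent\<close>). With \<open>c = 1/n\<close> this exhibits convolution roots, so
  these laws are infinitely divisible and can be fed into the next mapping.

  The mapping with parameter \<open>\<beta>\<close> is the case \<open>V = U powr (1/\<beta>)\<close>, whose distribution function is
  \<open>t powr \<beta>\<close> (\<open>J_map_eq_time_change\<close>). Composing mappings therefore averages \<open>\<psi>\<close> over one more
  independent factor each time, so the composition has exponent \<open>E \<psi>(V u)\<close> with \<open>V\<close> the product of
  all factors (\<open>J_comp_exponent\<close>). The single integral against the distribution function of that
  product has the same exponent, hence the same law.

  For the explicit formulas, conditioning on the last factor gives, with \<open>b = \<beta> (k + 1)\<close>,
  \<open>F (k + 1) t = t powr b + \<integral> F k (t z powr (-1/b)) dz\<close> over \<open>t powr b \<le> z \<le> 1\<close>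
  (\<open>product_cdf_Suc\<close>), from which both follow by induction on the number of factors. For distinct
  parameters the integration leaves a multiple of \<open>t powr b\<close>, and its coefficient is found from
  the fact that the coefficients sum to 1, which is Lagrange interpolation of the constant 1
  evaluated at 0 (\<open>sum_coeff_C\<close>).
\<close>

section \<open>Characteristic functions on Euclidean spaces\<close>

definition char_vec :: "'a::euclidean_space measure \<Rightarrow> 'a \<Rightarrow> complex" where
  "char_vec M u = (\<integral>x. iexp (u \<bullet> x) \<partial>M)"

lemma integrable_bounded_prob:
  fixes f :: "'w \<Rightarrow> 'b::{banach, second_countable_topology}"
  assumes "prob_space M" "f \<in> borel_measurable M" "\<And>\<omega>. \<omega> \<in> space M \<Longrightarrow> norm (f \<omega>) \<le> B"
  shows "integrable M f"
proof -
  interpret prob_space M by fact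
  show ?thesis by (rule integrable_const_bound[where B=B]) (use assms in auto)
qed

text \<open>The weight \<open>w\<close>, divided by its mean, is a probability density. Under the tilted measure \<open>V\<close>
  has characteristic function \<open>E(w exp(i t V)) / E w\<close>, and the two means agree by taking \<open>t = 0\<close>, so
  one-dimensional uniqueness applies. The bounds 1 and 3 are those of \<open>2 + w\<close> for \<open>-1 \<le> w \<le> 1\<close>.\<close>

lemma weighted_char_unique_nonneg:
  fixes V :: "'w \<Rightarrow> real" and V' :: "'v \<Rightarrow> real"
  assumes M: "prob_space M" "prob_space M'"
    and [measurable]: "V \<in> borel_measurable M" "V' \<in> borel_measurable M'"
      "w \<in> borel_measurable M" "w' \<in> borel_measurable M'"
    and w: "\<And>\<omega>. 1 \<le> w \<omega> \<and> w \<omega> \<le> 3" "\<And>\<omega>. 1 \<le> w' \<omega> \<and> w' \<omega> \<le> 3"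
    and eq: "\<And>t. (\<integral>\<omega>. of_real (w \<omega>) * iexp (t * V \<omega>) \<partial>M) = (\<integral>\<omega>. of_real (w' \<omega>) * iexp (t * V' \<omega>) \<partial>M')"
    and A: "A \<in> sets borel"
  shows "(\<integral>\<omega>. w \<omega> * indicator A (V \<omega>) \<partial>M) = (\<integral>\<omega>. w' \<omega> * indicator A (V' \<omega>) \<partial>M')"
proof -
  define c where "c = (\<integral>\<omega>. w \<omega> \<partial>M)"
  have c': "c = (\<integral>\<omega>. w' \<omega> \<partial>M')"
    using eq[of 0] by (simp add: c_def)
  have main: "1 \<le> (\<integral>\<omega>. w \<omega> \<partial>M)
      \<and> real_distribution (distr (density M (\<lambda>\<omega>. ennreal (w \<omega> / (\<integral>\<omega>. w \<omega> \<partial>M)))) borel V)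
      \<and> char (distr (density M (\<lambda>\<omega>. ennreal (w \<omega> / (\<integral>\<omega>. w \<omega> \<partial>M)))) borel V)
         = (\<lambda>t. (\<integral>\<omega>. of_real (w \<omega>) * iexp (t * V \<omega>) \<partial>M) / of_real (\<integral>\<omega>. w \<omega> \<partial>M))
      \<and> measure (distr (density M (\<lambda>\<omega>. ennreal (w \<omega> / (\<integral>\<omega>. w \<omega> \<partial>M)))) borel V) A
         = (\<integral>\<omega>. w \<omega> * indicator A (V \<omega>) \<partial>M) / (\<integral>\<omega>. w \<omega> \<partial>M)"
    if M: "prob_space M" and [measurable]: "V \<in> borel_measurable M" "w \<in> borel_measurable M"
      and w: "\<And>\<omega>. 1 \<le> w \<omega> \<and> w \<omega> \<le> 3" for M :: "'z measure" and V w
  proof -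
    interpret prob_space M by fact
    have iw: "integrable M w"
    proof (rule integrable_bounded_prob[where B=3])
      show "norm (w \<omega>) \<le> 3" for \<omega> using w[of \<omega>] by auto
    qed (use M in auto)
    let ?c = "\<integral>\<omega>. w \<omega> \<partial>M"
    let ?D = "density M (\<lambda>\<omega>. ennreal (w \<omega> / ?c))"
    have c1: "1 \<le> ?c"
      using integral_mono[of M "\<lambda>_. 1" w] iw w by (simp add: prob_space)
    have w0: "0 \<le> w \<omega>" for \<omega> using w[of \<omega>] by auto
    have "(\<integral>\<^sup>+\<omega>. ennreal (w \<omega> / ?c) \<partial>M) = ennreal (\<integral>\<omega>. w \<omega> / ?c \<partial>M)"
      by (rule nn_integral_eq_integral) (use iw w0 c1 in auto)
    also have "\<dots> = 1" using c1 by simp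
    finally have "emeasure ?D (space ?D) = 1"
      by (simp add: emeasure_density cong: nn_integral_cong)
    then have pD: "prob_space ?D" by (rule prob_spaceI)
    have [measurable]: "V \<in> borel_measurable ?D" by simp
    have rd: "real_distribution (distr ?D borel V)"
      by (rule prob_space.real_distribution_distr[OF pD]) simp
    have ch: "char (distr ?D borel V) t = (\<integral>\<omega>. of_real (w \<omega>) * iexp (t * V \<omega>) \<partial>M) / of_real ?c" for t
    proof -
      have "char (distr ?D borel V) t = (\<integral>\<omega>. iexp (t * V \<omega>) \<partial>?D)"
        by (simp add: char_def integral_distr)
      also have "\<dots> = (\<integral>\<omega>. (w \<omega> / ?c) *\<^sub>R iexp (t * V \<omega>) \<partial>M)"
        by (rule integral_density) (use w0 c1 in auto)
      also have "\<dots> = (\<integral>\<omega>. of_real (w \<omega>) * iexp (t * V \<omega>) / of_real ?c \<partial>M)"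
        by (simp add: scaleR_conv_of_real)
      finally show ?thesis by simp
    qed
    have "measure (distr ?D borel V) A = (\<integral>x. indicator A x \<partial>distr ?D borel V)"
      using A by simp
    also have "\<dots> = (\<integral>\<omega>. indicator A (V \<omega>) \<partial>?D)"
      using A by (intro integral_distr) auto
    also have "\<dots> = (\<integral>\<omega>. (w \<omega> / ?c) *\<^sub>R indicator A (V \<omega>) \<partial>M)"
      using A by (intro integral_density) (use w0 c1 in auto)
    finally have "measure (distr ?D borel V) A = (\<integral>\<omega>. w \<omega> * indicator A (V \<omega>) \<partial>M) / ?c"
      by simp
    with c1 rd ch show ?thesis by auto
  qed
  note m1 = main[OF M(1) assms(3,5) w(1)]
  note m2 = main[OF M(2) assms(4,6) w(2)]
  have "distr (density M (\<lambda>\<omega>. ennreal (w \<omega> / (\<integral>\<omega>. w \<omega> \<partial>M)))) borel V =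
        distr (density M' (\<lambda>\<omega>. ennreal (w' \<omega> / (\<integral>\<omega>. w' \<omega> \<partial>M')))) borel V'"
    by (rule Levy_uniqueness) (use m1 m2 eq c' c_def in auto)
  then have "(\<integral>\<omega>. w \<omega> * indicator A (V \<omega>) \<partial>M) / c = (\<integral>\<omega>. w' \<omega> * indicator A (V' \<omega>) \<partial>M') / c"
    using m1 m2 c' c_def by metis
  moreover have "c \<ge> 1" using m1 c_def by simp
  ultimately show ?thesis by simp
qed

text \<open>A signed weight is made positive by adding 2; the constant weight 2 is subtracted afterwards.\<close>

lemma weighted_char_unique_real:
  fixes V :: "'w \<Rightarrow> real" and V' :: "'v \<Rightarrow> real"
  assumes M: "prob_space M" "prob_space M'"
    and [measurable]: "V \<in> borel_measurable M" "V' \<in> borel_measurable M'"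
      "w \<in> borel_measurable M" "w' \<in> borel_measurable M'"
    and w: "\<And>\<omega>. \<bar>w \<omega>\<bar> \<le> 1" "\<And>\<omega>. \<bar>w' \<omega>\<bar> \<le> 1"
    and eq1: "\<And>t. (\<integral>\<omega>. iexp (t * V \<omega>) \<partial>M) = (\<integral>\<omega>. iexp (t * V' \<omega>) \<partial>M')"
    and eq: "\<And>t. (\<integral>\<omega>. of_real (w \<omega>) * iexp (t * V \<omega>) \<partial>M) = (\<integral>\<omega>. of_real (w' \<omega>) * iexp (t * V' \<omega>) \<partial>M')"
    and A: "A \<in> sets borel"
  shows "(\<integral>\<omega>. w \<omega> * indicator A (V \<omega>) \<partial>M) = (\<integral>\<omega>. w' \<omega> * indicator A (V' \<omega>) \<partial>M')"
proof -
  note [measurable] = A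
  have i: "integrable M (\<lambda>\<omega>. of_real (w \<omega>) * iexp (t * V \<omega>))" "integrable M (\<lambda>\<omega>. iexp (t * V \<omega>))" 
      "integrable M (\<lambda>\<omega>. w \<omega> * indicator A (V \<omega>))" "integrable M (\<lambda>\<omega>. indicator A (V \<omega>) :: real)"
    if "prob_space M" "V \<in> borel_measurable M"  "w \<in> borel_measurable M" "\<And>\<omega>. \<bar>w \<omega>\<bar> \<le> 1"
    for M :: "'z measure" and V w t
    by (rule integrable_bounded_prob[where B=1]; use that in \<open>auto simp: norm_mult indicator_def\<close>)+
  note i1 = i[OF M(1) assms(3,5) w(1)]
  note i2 = i[OF M(2) assms(4,6) w(2)]
  have "(\<integral>\<omega>. (2 + w \<omega>) * indicator A (V \<omega>) \<partial>M) = (\<integral>\<omega>. (2 + w' \<omega>) * indicator A (V' \<omega>) \<partial>M')"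
  proof (rule weighted_char_unique_nonneg[OF M])
    show "1 \<le> 2 + w \<omega> \<and> 2 + w \<omega> \<le> 3" for \<omega> using w(1)[of \<omega>] by auto
    show "1 \<le> 2 + w' \<omega> \<and> 2 + w' \<omega> \<le> 3" for \<omega> using w(2)[of \<omega>] by auto
    show "(\<integral>\<omega>. of_real (2 + w \<omega>) * iexp (t * V \<omega>) \<partial>M) = (\<integral>\<omega>. of_real (2 + w' \<omega>) * iexp (t * V' \<omega>) \<partial>M')" for t
      using i1(1)[of t] i1(2)[of t] i2(1)[of t] i2(2)[of t] eq[of t] eq1[of t] by (simp add: distrib_right)
  qed (use A in auto)
  moreover have "(\<integral>\<omega>. (2::real) * indicator A (V \<omega>) \<partial>M) = (\<integral>\<omega>. 2 * indicator A (V' \<omega>) \<partial>M')"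
    by (rule weighted_char_unique_nonneg[OF M]) (use A eq1 in auto)
  ultimately show ?thesis
    using i1 i2 by (simp add: distrib_right)
qed

text \<open>Replacing \<open>t\<close> by \<open>-t\<close> and conjugating gives access to the conjugate of \<open>W\<close>, hence to its real and
  imaginary parts separately.\<close>

lemma weighted_char_unique:
  fixes V :: "'w \<Rightarrow> real" and V' :: "'v \<Rightarrow> real"
  assumes M: "prob_space M" "prob_space M'"
    and [measurable]: "V \<in> borel_measurable M" "V' \<in> borel_measurable M'"
      "W \<in> borel_measurable M" "W' \<in> borel_measurable M'"
    and w: "\<And>\<omega>. cmod (W \<omega>) \<le> 1" "\<And>\<omega>. cmod (W' \<omega>) \<le> 1"
    and eq1: "\<And>t. (\<integral>\<omega>. iexp (t * V \<omega>) \<partial>M) = (\<integral>\<omega>. iexp (t * V' \<omega>) \<partial>M')"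
    and eq: "\<And>t. (\<integral>\<omega>. W \<omega> * iexp (t * V \<omega>) \<partial>M) = (\<integral>\<omega>. W' \<omega> * iexp (t * V' \<omega>) \<partial>M')"
    and A: "A \<in> sets borel"
  shows "(\<integral>\<omega>. W \<omega> * indicator A (V \<omega>) \<partial>M) = (\<integral>\<omega>. W' \<omega> * indicator A (V' \<omega>) \<partial>M')"
proof -
  note [measurable] = A
  have i: "integrable M (\<lambda>\<omega>. W \<omega> * iexp (t * V \<omega>))" "integrable M (\<lambda>\<omega>. W \<omega> * indicator A (V \<omega>))"
    if "prob_space M" "V \<in> borel_measurable M"  "W \<in> borel_measurable M" "\<And>\<omega>. cmod (W \<omega>) \<le> 1"
    for M :: "'z measure" and V W t
    by (rule integrable_bounded_prob[where B=1]; use that in \<open>auto simp: norm_mult indicator_def\<close>)+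
  note i1 = i[OF M(1) assms(3,5) w(1)]
  note i2 = i[OF M(2) assms(4,6) w(2)]
  have Re: "(\<integral>\<omega>. of_real (Re (W \<omega>)) * iexp (t * V \<omega>) \<partial>M)
      = ((\<integral>\<omega>. W \<omega> * iexp (t * V \<omega>) \<partial>M) + cnj (\<integral>\<omega>. W \<omega> * iexp (- t * V \<omega>) \<partial>M)) / 2"
    if i: "\<And>t. integrable M (\<lambda>\<omega>. W \<omega> * iexp (t * V \<omega>))"
    for M :: "'z measure" and V W t
  proof -
    have "of_real (Re (W \<omega>)) * iexp (t * V \<omega>) = (W \<omega> * iexp (t * V \<omega>) + cnj (W \<omega> * iexp (- t * V \<omega>))) / 2" for \<omega>
      by (simp add: exp_cnj complex_eq_iff algebra_simps)
    then have "(\<integral>\<omega>. of_real (Re (W \<omega>)) * iexp (t * V \<omega>) \<partial>M) =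
       (\<integral>\<omega>. (W \<omega> * iexp (t * V \<omega>) + cnj (W \<omega> * iexp (- t * V \<omega>))) / 2 \<partial>M)"
      by (rule Bochner_Integration.integral_cong[OF refl])
    also have "\<dots> = ((\<integral>\<omega>. W \<omega> * iexp (t * V \<omega>) \<partial>M) + (\<integral>\<omega>. cnj (W \<omega> * iexp (- t * V \<omega>)) \<partial>M)) / 2"
      using i[of t] complex_integrable_cnj[of M "\<lambda>\<omega>. W \<omega> * iexp (- t * V \<omega>)"] i[of "-t"] by (subst integral_divide_zero, subst Bochner_Integration.integral_add) auto
    finally show ?thesis by (simp only: Bochner_Integration.integral_cnj)
  qed
  have Im: "(\<integral>\<omega>. of_real (Im (W \<omega>)) * iexp (t * V \<omega>) \<partial>M)
      = ((\<integral>\<omega>. W \<omega> * iexp (t * V \<omega>) \<partial>M) - cnj (\<integral>\<omega>. W \<omega> * iexp (- t * V \<omega>) \<partial>M)) / (2 * \<i>)"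
    if i: "\<And>t. integrable M (\<lambda>\<omega>. W \<omega> * iexp (t * V \<omega>))"
    for M :: "'z measure" and V W t
  proof -
    have "of_real (Im (W \<omega>)) * iexp (t * V \<omega>) = (W \<omega> * iexp (t * V \<omega>) - cnj (W \<omega> * iexp (- t * V \<omega>))) / (2 * \<i>)" for \<omega>
      by (subst eq_divide_eq) (simp add: exp_cnj complex_eq_iff algebra_simps)
    then have "(\<integral>\<omega>. of_real (Im (W \<omega>)) * iexp (t * V \<omega>) \<partial>M) =
       (\<integral>\<omega>. (W \<omega> * iexp (t * V \<omega>) - cnj (W \<omega> * iexp (- t * V \<omega>))) / (2 * \<i>) \<partial>M)"
      by (rule Bochner_Integration.integral_cong[OF refl])
    also have "\<dots> = ((\<integral>\<omega>. W \<omega> * iexp (t * V \<omega>) \<partial>M) - (\<integral>\<omega>. cnj (W \<omega> * iexp (- t * V \<omega>)) \<partial>M)) / (2 * \<i>)"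
      using i[of t] complex_integrable_cnj[of M "\<lambda>\<omega>. W \<omega> * iexp (- t * V \<omega>)"] i[of "-t"] by (subst integral_divide_zero, subst Bochner_Integration.integral_diff) auto
    finally show ?thesis by (simp only: Bochner_Integration.integral_cnj)
  qed
  have "(\<integral>\<omega>. Re (W \<omega>) * indicator A (V \<omega>) \<partial>M) = (\<integral>\<omega>. Re (W' \<omega>) * indicator A (V' \<omega>) \<partial>M')"
  proof (rule weighted_char_unique_real[OF M])
    show "\<bar>Re (W \<omega>)\<bar> \<le> 1" for \<omega> using w(1)[of \<omega>] abs_Re_le_cmod[of "W \<omega>"] by auto
    show "\<bar>Re (W' \<omega>)\<bar> \<le> 1" for \<omega> using w(2)[of \<omega>] abs_Re_le_cmod[of "W' \<omega>"] by auto
    show "(\<integral>\<omega>. of_real (Re (W \<omega>)) * iexp (t * V \<omega>) \<partial>M) = (\<integral>\<omega>. of_real (Re (W' \<omega>)) * iexp (t * V' \<omega>) \<partial>M')" for t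
      by (simp only: Re[OF i1(1)] Re[OF i2(1)] eq)
  qed (use eq1 A in auto)
  moreover have "(\<integral>\<omega>. Im (W \<omega>) * indicator A (V \<omega>) \<partial>M) = (\<integral>\<omega>. Im (W' \<omega>) * indicator A (V' \<omega>) \<partial>M')"
  proof (rule weighted_char_unique_real[OF M])
    show "\<bar>Im (W \<omega>)\<bar> \<le> 1" for \<omega> using w(1)[of \<omega>] abs_Im_le_cmod[of "W \<omega>"] by auto
    show "\<bar>Im (W' \<omega>)\<bar> \<le> 1" for \<omega> using w(2)[of \<omega>] abs_Im_le_cmod[of "W' \<omega>"] by auto
    show "(\<integral>\<omega>. of_real (Im (W \<omega>)) * iexp (t * V \<omega>) \<partial>M) = (\<integral>\<omega>. of_real (Im (W' \<omega>)) * iexp (t * V' \<omega>) \<partial>M')" for t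
      by (simp only: Im[OF i1(1)] Im[OF i2(1)] eq)
  qed (use eq1 A in auto)
  moreover have "Re (W \<omega> * indicator A (V \<omega>)) = Re (W \<omega>) * indicator A (V \<omega>)"
    "Im (W \<omega> * indicator A (V \<omega>)) = Im (W \<omega>) * indicator A (V \<omega>)" 
    "Re (W' \<omega>' * indicator A (V' \<omega>')) = Re (W' \<omega>') * indicator A (V' \<omega>')"
    "Im (W' \<omega>' * indicator A (V' \<omega>')) = Im (W' \<omega>') * indicator A (V' \<omega>')" for \<omega> \<omega>'
    by (auto simp: indicator_def)
  ultimately show ?thesis
    unfolding complex_eq_iff integral_Re[OF i1(2), symmetric] integral_Im[OF i1(2), symmetric]
       integral_Re[OF i2(2), symmetric] integral_Im[OF i2(2), symmetric] by simp
qed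

text \<open>Indicators of events about the coordinates \<open>x \<bullet> b\<close> are multiplied into \<open>E exp(i u \<bullet> x)\<close> one
  at a time. The integrand reached so far is the complex weight in one-dimensional uniqueness for
  \<open>x \<bullet> b\<close>, and multiplying it by \<open>exp(i t (x \<bullet> b))\<close> only changes \<open>u\<close> to \<open>u + t b\<close>. With an indicator for
  every coordinate and \<open>u = 0\<close>, the measures agree on boxes.\<close>

theorem char_vec_unique:
  fixes \<mu> \<mu>' :: "'a::euclidean_space measure"
  assumes "prob_space \<mu>" "prob_space \<mu>'" and s: "sets \<mu> = sets borel" "sets \<mu>' = sets borel"
    and eq: "\<And>u. char_vec \<mu> u = char_vec \<mu>' u"
  shows "\<mu> = \<mu>'"
proof -
  interpret m: prob_space \<mu> by fact
  interpret m': prob_space \<mu>' by fact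
  note [measurable_cong] = s
  have key: "(\<integral>x. (\<Prod>b\<in>S. indicator (A b) (x \<bullet> b)) * iexp (u \<bullet> x) \<partial>\<mu>)
      = (\<integral>x. (\<Prod>b\<in>S. indicator (A b) (x \<bullet> b)) * iexp (u \<bullet> x) \<partial>\<mu>')"
    if "finite S" and A: "\<And>b. A b \<in> sets borel" for S :: "'a set" and A :: "'a \<Rightarrow> real set" and u
    using \<open>finite S\<close>
  proof (induction S arbitrary: u)
    case empty
    then show ?case using eq[of u] by (simp add: char_vec_def)
  next
    case (insert b S)
    note [measurable] = A
    let ?W = "\<lambda>x. (\<Prod>b\<in>S. indicator (A b) (x \<bullet> b)) * iexp (u \<bullet> x)"
    have "cmod (\<Prod>b\<in>S. indicator (A b) (x \<bullet> b)) \<le> 1" for x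
      unfolding prod_norm[symmetric] by (rule prod_le_1) (auto simp: indicator_def)
    then have W: "cmod (?W x) \<le> 1" for x
      by (simp add: norm_mult)
    have "(\<integral>x. ?W x * indicator (A b) (x \<bullet> b) \<partial>\<mu>) = (\<integral>x. ?W x * indicator (A b) (x \<bullet> b) \<partial>\<mu>')"
    proof (rule weighted_char_unique)
      show "(\<integral>x. iexp (t * (x \<bullet> b)) \<partial>\<mu>) = (\<integral>x. iexp (t * (x \<bullet> b)) \<partial>\<mu>')" for t
        using eq[of "t *\<^sub>R b"] by (simp add: char_vec_def inner_commute)
      have W_iexp: "?W x * iexp (t * (x \<bullet> b)) = (\<Prod>b\<in>S. indicator (A b) (x \<bullet> b)) * iexp ((u + t *\<^sub>R b) \<bullet> x)" for x t
        by (simp add: inner_add_left inner_commute[of x b] distrib_left exp_add)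
      show "(\<integral>x. ?W x * iexp (t * (x \<bullet> b)) \<partial>\<mu>) = (\<integral>x. ?W x * iexp (t * (x \<bullet> b)) \<partial>\<mu>')" for t
        by (simp only: W_iexp insert.IH)
    qed (use assms W A in auto)
    then show ?case using insert by (simp add: mult_ac)
  qed
  have box: "emeasure \<mu> (box l r) = emeasure \<mu>' (box l r)" for l r :: 'a
  proof -
    have ind: "(\<Prod>b\<in>Basis. indicator {l\<bullet>b<..<r\<bullet>b} (x \<bullet> b)) = complex_of_real (indicator (box l r) x)" for x
      by (cases "x \<in> box l r") (force simp: box_def prod_zero_iff indicator_def intro!: prod.neutral)+
    have "measure \<mu> (box l r) = measure \<mu>' (box l r)"
      using key[of Basis "\<lambda>b. {l\<bullet>b<..<r\<bullet>b}" 0] by (simp add: ind s)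
    then show ?thesis by (simp add: m.emeasure_eq_measure m'.emeasure_eq_measure)
  qed
  show ?thesis
  proof (rule measure_eqI_generator_eq)
    let ?E = "range (\<lambda>(a, b). box a b::'a set)"
    show "Int_stable ?E" by (auto simp: Int_stable_def box_Int_box)
    show "?E \<subseteq> Pow UNIV" "sets \<mu> = sigma_sets UNIV ?E" "sets \<mu>' = sigma_sets UNIV ?E"
      by (simp_all add: borel_eq_box s)
    let ?A = "\<lambda>n::nat. box (- (real n *\<^sub>R One)) (real n *\<^sub>R One) :: 'a set"
    show "range ?A \<subseteq> ?E" "(\<Union>i. ?A i) = UNIV" unfolding UN_box_eq_UNIV by auto
    show "emeasure \<mu> (?A i) \<noteq> \<infinity>" for i by simp
    show "emeasure \<mu> X = emeasure \<mu>' X" if "X \<in> ?E" for X using that box by auto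
  qed
qed

section \<open>Exponential semigroups and continuous exponents\<close>

text \<open>The primitive \<open>G\<close> of \<open>g\<close> satisfies \<open>G (t + d) - G t = g t * G d\<close>. Dividing by \<open>G d\<close>, nonzero for
  small \<open>d\<close>, shows that \<open>g\<close> is differentiable with \<open>g' = c * g\<close>.\<close>

lemma exp_semigroup:
  fixes g :: "real \<Rightarrow> complex"
  assumes g0: "g 0 = 1"
    and mult: "\<And>s t. 0 \<le> s \<Longrightarrow> 0 \<le> t \<Longrightarrow> g (s + t) = g s * g t"
    and bound: "\<And>t. 0 \<le> t \<Longrightarrow> cmod (g t) \<le> 1"
    and lim: "(g \<longlongrightarrow> 1) (at_right 0)"
  shows "\<exists>c. \<forall>t\<ge>0. g t = exp (of_real t * c)"
proof -
  have small: "\<exists>d>0. \<forall>h. 0 \<le> h \<and> h < d \<longrightarrow> cmod (g h - 1) < e" if "e > 0" for e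
  proof -
    have "\<forall>\<^sub>F h in at_right 0. dist (g h) 1 < e" using lim that by (rule tendstoD)
    then obtain d where "d > 0" "\<forall>h>0. h < d \<longrightarrow> dist (g h) 1 < e"
      unfolding eventually_at_right_field by auto
    then show ?thesis using g0 that by (intro exI[of _ d]) (auto simp: dist_norm order_le_less)
  qed
  have diff: "cmod (g t - g s) \<le> cmod (g (t - s) - 1)" if "0 \<le> s" "s \<le> t" for s t
  proof -
    have "g t - g s = g s * (g (t - s) - 1)"
      using mult[of s "t - s"] that by (simp add: algebra_simps)
    then show ?thesis using bound[OF that(1)] by (simp add: norm_mult mult_left_le_one_le)
  qed
  have cont: "continuous_on {0..} g"
    unfolding continuous_on_iff
  proof (intro ballI allI impI)
    fix x e :: real assume "x \<in> {0..}" "e > 0"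
    obtain d where d: "d > 0" "\<And>h. 0 \<le> h \<Longrightarrow> h < d \<Longrightarrow> cmod (g h - 1) < e"
      using small[OF \<open>e > 0\<close>] by blast
    show "\<exists>d>0. \<forall>y\<in>{0..}. dist y x < d \<longrightarrow> dist (g y) (g x) < e"
    proof (intro exI[of _ d] conjI ballI impI)
      fix y assume "y \<in> {0..}" "dist y x < d"
      then show "dist (g y) (g x) < e"
        using diff[of x y] diff[of y x] d(2)[of "\<bar>y - x\<bar>"] \<open>x \<in> {0..}\<close>
        by (cases "x \<le> y") (auto simp: dist_norm norm_minus_commute)
    qed (fact d)
  qed
  define G where "G t = integral {0..t} g" for t
  have Gd: "(G has_vector_derivative g t) (at t within {0..b})" if "t \<in> {0..b}" for t b
    unfolding G_def by (rule integral_has_vector_derivative[OF continuous_on_subset[OF cont] that]) auto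
  obtain d where d: "d > 0" "G d \<noteq> 0"
  proof -
    obtain d where d: "d > 0" "\<And>h. 0 \<le> h \<Longrightarrow> h < d \<Longrightarrow> cmod (g h - 1) < 1/2"
      using small[of "1/2"] by auto
    let ?d = "d / 2"
    have i: "(\<lambda>t. g t - 1) integrable_on {0..?d}"
      by (intro integrable_continuous_interval continuous_intros continuous_on_subset[OF cont]) auto
    have "cmod (integral {0..?d} (\<lambda>t. g t - 1)) \<le> 1/2 * (?d - 0)"
    proof (rule integral_bound)
      show "continuous_on {0..?d} (\<lambda>t. g t - 1)"
        by (intro continuous_intros continuous_on_subset[OF cont]) auto
      show "cmod (g t - 1) \<le> 1/2" if "t \<in> {0..?d}" for t using that d by (auto intro!: less_imp_le)
    qed (use d in auto)
    moreover have "integral {0..?d} (\<lambda>t. g t - 1) = G ?d - of_real ?d"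
      unfolding G_def using d(1)
      by (subst Henstock_Kurzweil_Integration.integral_diff)
        (auto intro!: integrable_continuous_interval continuous_intros continuous_on_subset[OF cont] simp: scaleR_conv_of_real)
    ultimately have "cmod (G ?d - of_real ?d) < ?d" using d(1) by auto
    then have "G ?d \<noteq> 0" using d(1) by (auto simp: norm_minus_commute)
    then show ?thesis using that[of ?d] d(1) by auto
  qed
  have shift: "G (t + d) - G t = g t * G d" if "0 \<le> t" for t
  proof -
    have ii: "g integrable_on {a..b}" if "0 \<le> a" for a b
      using that by (intro integrable_continuous_interval continuous_on_subset[OF cont]) auto
    have "G t + integral {t..t+d} g = G (t + d)"
      unfolding G_def by (rule Henstock_Kurzweil_Integration.integral_combine) (use that d ii in auto)
    moreover have "integral {t..t+d} g = integral {0..d} (\<lambda>s. g (s + t))"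
      using integral_shift_real_ivl[where c=t and f=g and a=t and b="t+d"] by (simp add: algebra_simps)
    moreover have "integral {0..d} (\<lambda>s. g (s + t)) = integral {0..d} (\<lambda>s. g s * g t)"
      by (rule Henstock_Kurzweil_Integration.integral_cong) (use mult that in auto)
    ultimately show ?thesis by (simp add: G_def algebra_simps)
  qed
  define c where "c = (g d - 1) / G d"
  have gd: "(g has_vector_derivative c * g t) (at t within {0..b})" if "t \<in> {0..b}" for t b
  proof -
    have *: "((\<lambda>t. (G (t + d) - G t) / G d) has_vector_derivative (g (t + d) - g t) / G d) (at t within {0..b})"
    proof -
      have "((\<lambda>t. G (t + d)) has_vector_derivative g (t + d)) (at t within {0..b})"
      proof -
        have "(G has_vector_derivative g (t + d)) (at (t + d) within {0..b+d})"
          using that d by (intro Gd) auto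
        then have "(G has_vector_derivative g (t + d)) (at (t + d) within (\<lambda>t. t + d) ` {0..b})"
          by (rule has_vector_derivative_within_subset) (use d in auto)
        then have "((G \<circ> (\<lambda>t. t + d)) has_vector_derivative 1 *\<^sub>R g (t + d)) (at t within {0..b})"
          by (intro vector_diff_chain_within) (auto intro!: derivative_eq_intros)
        then show ?thesis by (simp add: o_def)
      qed
      from has_vector_derivative_diff[OF this Gd[OF that]] show ?thesis
        by (rule has_vector_derivative_divide)
    qed
    have "(g has_vector_derivative (g (t + d) - g t) / G d) (at t within {0..b})"
      by (rule has_vector_derivative_transform[OF that _ *]) (use shift d in \<open>auto simp: field_simps\<close>)
    moreover have "(g (t + d) - g t) / G d = c * g t"
      using mult[of t d] that d by (simp add: c_def field_simps)
    ultimately show ?thesis by simp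
  qed
  have "g t = exp (of_real t * c)" if t: "0 \<le> t" for t
  proof -
    have "((\<lambda>s. g s * exp (- (of_real s * c))) has_vector_derivative 0) (at s within {0..t})" if "s \<in> {0..t}" for s
      by (rule derivative_eq_intros gd[OF that] has_vector_derivative_real_field DERIV_subset[where s=UNIV] refl| simp add: algebra_simps)+
    then obtain k where "\<And>s. s \<in> {0..t} \<Longrightarrow> g s * exp (- (of_real s * c)) = k"
      using has_vector_derivative_zero_constant[of "{0..t}" "\<lambda>s. g s * exp (- (of_real s * c))"] by auto
    then have "g t * exp (- (of_real t * c)) = g 0 * exp (- (of_real 0 * c))"
      using t by (metis atLeastAtMost_iff order_refl)
    then show ?thesis using g0 by (simp add: exp_minus field_simps)
  qed
  then show ?thesis by blast
qed

text \<open>Wherever the integral is nonzero, this recovers \<open>c\<close> itself from the values of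
  \<open>exp (t * c)\<close>, without choosing a branch of the logarithm.\<close>

lemma exp_semigroup_integral:
  fixes c :: complex
  assumes "0 \<le> d"
  shows "c * integral {0..d} (\<lambda>t. exp (of_real t * c)) = exp (of_real d * c) - 1"
proof -
  have "((\<lambda>t. c * exp (of_real t * c)) has_integral (exp (of_real d * c) - exp (of_real 0 * c))) {0..d}"
    by (rule fundamental_theorem_of_calculus[OF assms])
       (auto intro!: derivative_eq_intros has_vector_derivative_real_field)
  then show ?thesis by (metis exp_zero integral_mult_right integral_unique mult_zero_left of_real_0)
qed

text \<open>Near each \<open>u\<close>, \<open>\<psi>\<close> is a quotient of two functions that are continuous by
  assumption and by dominated convergence, namely \<open>exp (d * \<psi>) - 1\<close> and the integral of
  \<open>exp (t * \<psi>)\<close> over \<open>0 \<le> t \<le> d\<close>, for a \<open>d\<close> at which the latter does not vanish.\<close>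

lemma continuous_exponent:
  fixes \<psi> :: "'a::euclidean_space \<Rightarrow> complex"
  assumes cont: "\<And>t. 0 \<le> t \<Longrightarrow> continuous_on UNIV (\<lambda>u. exp (of_real t * \<psi> u))"
    and bound: "\<And>t u. 0 \<le> t \<Longrightarrow> cmod (exp (of_real t * \<psi> u)) \<le> 1"
  shows "continuous_on UNIV \<psi>"
proof -
  define K where "K d u = integral {0..d} (\<lambda>t. exp (of_real t * \<psi> u))" for d u
  have ex: "\<exists>d>0. K d u \<noteq> 0" for u
  proof (cases "\<psi> u = 0")
    case True
    then show ?thesis by (intro exI[of _ 1]) (simp add: K_def)
  next
    case False
    \<comment> \<open>This makes \<open>?d * \<psi> u\<close> a number of modulus 1, which is no multiple of \<open>2 * pi * \<i>\<close>.\<close>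
    let ?d = "1 / cmod (\<psi> u)"
    have "K ?d u \<noteq> 0"
    proof
      assume "K ?d u = 0"
      then have "exp (of_real ?d * \<psi> u) = 1"
        using exp_semigroup_integral[of ?d "\<psi> u"] by (simp add: K_def)
      then obtain n :: int where n: "Re (of_real ?d * \<psi> u) = 0" "Im (of_real ?d * \<psi> u) = of_int (2 * n) * pi"
        unfolding exp_eq_1 by auto
      have "cmod (of_real ?d * \<psi> u) = 1" using False by (simp add: norm_mult norm_divide)
      moreover have "cmod (of_real ?d * \<psi> u) = \<bar>of_int (2 * n) * pi\<bar>"
        unfolding cmod_def[of "of_real ?d * \<psi> u"] n by simp
      ultimately have *: "2 * pi * of_int \<bar>n\<bar> = 1" by (simp add: abs_mult mult_ac)
      show False
      proof (cases "n = 0")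
        case False
        then have "1 \<le> (of_int \<bar>n\<bar> :: real)" by linarith
        then have "2 * pi * 1 \<le> 2 * pi * of_int \<bar>n\<bar>" by (intro mult_left_mono) auto
        with * pi_gt3 show False by linarith
      qed (use * in simp)
    qed
    then show ?thesis using False by (intro exI[of _ ?d]) auto
  qed
  have Kc: "continuous_on UNIV (K d)" for d
    unfolding continuous_on_sequentially comp_def
  proof (intro allI ballI impI, elim conjE)
    fix x :: "nat \<Rightarrow> 'a" and a assume x: "x \<longlonglongrightarrow> a"
    show "(\<lambda>n. K d (x n)) \<longlonglongrightarrow> K d a"
      unfolding K_def
    proof (rule dominated_convergence(2)[where h="\<lambda>_. 1"])
      show "(\<lambda>n. exp (of_real t * \<psi> (x n))) \<longlonglongrightarrow> exp (of_real t * \<psi> a)" if "t \<in> {0..d}" for t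
        using continuous_on_tendsto_compose[OF cont x, of t] that by simp
    qed (use bound in \<open>auto intro!: integrable_continuous_interval continuous_intros\<close>)
  qed
  show ?thesis
    unfolding continuous_on_eq_continuous_at[OF open_UNIV]
  proof
    fix u
    obtain d where d: "d > 0" "K d u \<noteq> 0" using ex by blast
    have "isCont (\<lambda>v. (exp (of_real d * \<psi> v) - 1) / K d v) u"
      using Kc[of d] cont[of d] d
      by (intro isCont_divide isCont_diff continuous_const) (auto simp: continuous_on_eq_continuous_at)
    moreover have "\<forall>\<^sub>F v in nhds u. (exp (of_real d * \<psi> v) - 1) / K d v = \<psi> v"
    proof -
      have "open {v. K d v \<noteq> 0}" using Kc[of d] by (intro open_Collect_neq continuous_intros)
      then have "\<forall>\<^sub>F v in nhds u. K d v \<noteq> 0" using d(2) by (auto simp: eventually_nhds)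
      then show ?thesis
      proof eventually_elim
        case (elim v)
        then show ?case using exp_semigroup_integral[of d "\<psi> v"] d by (simp add: K_def field_simps)
      qed
    qed
    ultimately show "isCont \<psi> u" using isCont_cong by fast
  qed
qed

text \<open>The difference is continuous with values in the discrete set of multiples of \<open>2 * pi * \<i>\<close>, hence
  constant.\<close>

lemma exponent_unique:
  fixes \<psi> \<psi>' :: "'a::real_normed_vector \<Rightarrow> complex"
  assumes "continuous_on UNIV \<psi>" "continuous_on UNIV \<psi>'" "\<psi> 0 = \<psi>' 0"
    and eq: "\<And>u. exp (\<psi> u) = exp (\<psi>' u)"
  shows "\<psi> = \<psi>'"
proof -
  let ?f = "\<lambda>u. \<psi> u - \<psi>' u"
  have ex: "\<exists>n::int. ?f u = of_int (2 * n) * pi * \<i>" for u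
    using eq[of u] unfolding exp_eq by (auto simp: algebra_simps)
  have "?f constant_on UNIV"
  proof (rule continuous_discrete_range_constant)
    show "continuous_on UNIV ?f" by (intro continuous_intros assms)
    show "\<exists>e>0. \<forall>y. y \<in> UNIV \<and> ?f y \<noteq> ?f x \<longrightarrow> e \<le> cmod (?f y - ?f x)" for x
    proof (intro exI[of _ 1] conjI allI impI, simp, elim conjE)
      fix y assume ne: "?f y \<noteq> ?f x"
      obtain n k :: int where n: "?f y = of_int (2 * n) * pi * \<i>" "?f x = of_int (2 * k) * pi * \<i>" using ex by metis
      then have "n \<noteq> k" using ne by auto
      then have "1 \<le> (of_int \<bar>n - k\<bar> :: real)" by linarith
      moreover have "?f y - ?f x = of_real (2 * pi * of_int (n - k)) * \<i>" unfolding n by (simp add: algebra_simps)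
      then have "cmod (?f y - ?f x) = 2 * pi * of_int \<bar>n - k\<bar>" by (simp only: norm_mult norm_of_real) (simp add: abs_mult)
      moreover have "2 * pi * of_int \<bar>n - k\<bar> \<ge> 2 * pi * 1" using calculation(1) by (intro mult_left_mono) auto
      ultimately show "1 \<le> cmod (?f y - ?f x)" using pi_gt3 by linarith
    qed
  qed auto
  then obtain c where "\<And>u. ?f u = c" unfolding constant_on_def by auto
  with assms(3) have "\<And>u. ?f u = 0" by (metis diff_self)
  then show ?thesis by auto
qed

section \<open>The characteristic exponent of a Levy process\<close>

definition has_exponent :: "'a::euclidean_space measure \<Rightarrow> ('a \<Rightarrow> complex) \<Rightarrow> bool" where
  "has_exponent \<mu> \<psi> \<longleftrightarrow> prob_space \<mu> \<and> sets \<mu> = sets borel \<and>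
     continuous_on UNIV \<psi> \<and> \<psi> 0 = 0 \<and> (\<forall>u. char_vec \<mu> u = exp (\<psi> u))"

lemma has_exponent_unique: "has_exponent \<mu> \<psi> \<Longrightarrow> has_exponent \<mu> \<psi>' \<Longrightarrow> \<psi> = \<psi>'"
  by (rule exponent_unique) (auto simp: has_exponent_def)

lemma has_exponent_determines: "has_exponent \<mu> \<psi> \<Longrightarrow> has_exponent \<mu>' \<psi> \<Longrightarrow> \<mu> = \<mu>'"
  by (rule char_vec_unique) (auto simp: has_exponent_def)

lemma char_vec_distr:
  "X \<in> borel_measurable M \<Longrightarrow> char_vec (distr M borel X) u = (\<integral>\<omega>. iexp (u \<bullet> X \<omega>) \<partial>M)"
  by (simp add: char_vec_def integral_distr)

lemma char_vec_sum_iid: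
  assumes "prob_space \<rho>" and s: "sets \<rho> = sets borel"
  shows "char_vec (distr (\<Pi>\<^sub>M i\<in>{..<n}. \<rho>) borel (\<lambda>x. \<Sum>i<n. x i)) u = char_vec \<rho> u ^ n"
proof -
  interpret r: prob_space \<rho> by fact
  interpret p: product_sigma_finite "\<lambda>_::nat. \<rho>" by standard
  note [measurable_cong] = s
  have "char_vec (distr (\<Pi>\<^sub>M i\<in>{..<n}. \<rho>) borel (\<lambda>x. \<Sum>i<n. x i)) u
      = (\<integral>x. (\<Prod>i<n. iexp (u \<bullet> x i)) \<partial>(\<Pi>\<^sub>M i\<in>{..<n}. \<rho>))"
    by (subst char_vec_distr) (auto simp: inner_sum_right sum_distrib_left exp_sum)
  also have "\<dots> = (\<Prod>i<n. \<integral>x. iexp (u \<bullet> x) \<partial>\<rho>)"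
    by (rule p.product_integral_prod) (auto intro!: integrable_bounded_prob[where B=1] assms)
  finally show ?thesis by (simp add: char_vec_def)
qed

lemma levy_increments_char:
  assumes L: "levy_process M Y"
    and t: "\<And>i. i \<le> n \<Longrightarrow> 0 \<le> t i" "\<And>i. i < n \<Longrightarrow> t i \<le> t (Suc i)"
  shows "(\<integral>\<omega>. (\<Prod>i<n. iexp (v i \<bullet> (Y (t (Suc i)) \<omega> - Y (t i) \<omega>))) \<partial>M)
    = (\<Prod>i<n. \<integral>\<omega>. iexp (v i \<bullet> Y (t (Suc i) - t i) \<omega>) \<partial>M)"
proof -
  interpret prob_space M using L by (simp add: levy_process_def)
  have meas: "s \<ge> 0 \<Longrightarrow> Y s \<in> borel_measurable M" for s
    using L by (simp add: levy_process_def)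
  have "indep_vars (\<lambda>_. borel) (\<lambda>i \<omega>. Y (t (Suc i)) \<omega> - Y (t i) \<omega>) {..<n}"
    using L t by (simp add: levy_process_def)
  then have "indep_vars (\<lambda>_. borel) (\<lambda>i \<omega>. iexp (v i \<bullet> (Y (t (Suc i)) \<omega> - Y (t i) \<omega>))) {..<n}"
    by (rule indep_vars_compose2) simp
  then have "(\<integral>\<omega>. (\<Prod>i<n. iexp (v i \<bullet> (Y (t (Suc i)) \<omega> - Y (t i) \<omega>))) \<partial>M)
      = (\<Prod>i<n. \<integral>\<omega>. iexp (v i \<bullet> (Y (t (Suc i)) \<omega> - Y (t i) \<omega>)) \<partial>M)"
    using meas t by (intro indep_vars_lebesgue_integral) (auto intro!: integrable_bounded_prob[where B=1] prob_space_axioms)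
  also have "\<dots> = (\<Prod>i<n. \<integral>\<omega>. iexp (v i \<bullet> Y (t (Suc i) - t i) \<omega>) \<partial>M)"
  proof (rule prod.cong[OF refl])
    fix i assume "i \<in> {..<n}"
    then have ti: "0 \<le> t i" "t i \<le> t (Suc i)" "0 \<le> t (Suc i)" using t by auto
    have d: "distr M borel (\<lambda>\<omega>. Y (t i + (t (Suc i) - t i)) \<omega> - Y (t i) \<omega>) = distr M borel (Y (t (Suc i) - t i))"
    proof -
      have "\<forall>s\<ge>0. \<forall>t\<ge>0. distr M borel (\<lambda>\<omega>. Y (s + t) \<omega> - Y s \<omega>) = distr M borel (Y t)"
        using L by (simp add: levy_process_def)
      then have "0 \<le> t (Suc i) - t i \<Longrightarrow> ?thesis" using ti(1) by blast
      then show ?thesis using ti(2) by simp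
    qed
    have [measurable]: "Y (t i) \<in> borel_measurable M" "Y (t (Suc i)) \<in> borel_measurable M" "Y (t (Suc i) - t i) \<in> borel_measurable M"
      using ti by (auto intro!: meas)
    have "char_vec (distr M borel (\<lambda>\<omega>. Y (t (Suc i)) \<omega> - Y (t i) \<omega>)) (v i) = char_vec (distr M borel (Y (t (Suc i) - t i))) (v i)"
      using d by simp
    then show "(\<integral>\<omega>. iexp (v i \<bullet> (Y (t (Suc i)) \<omega> - Y (t i) \<omega>)) \<partial>M) = (\<integral>\<omega>. iexp (v i \<bullet> Y (t (Suc i) - t i) \<omega>) \<partial>M)"
      by (simp add: char_vec_distr)
  qed
  finally show ?thesis .
qed

text \<open>For fixed \<open>u\<close> the characteristic functions at the times \<open>t\<close> form a multiplicative semigroup,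
  by independence and stationarity of the increments, which is right continuous at 0 because the
  paths are.\<close>

lemma levy_process_exponent:
  fixes Y :: "real \<Rightarrow> 'w \<Rightarrow> 'a::euclidean_space"
  assumes L: "levy_process M Y"
  obtains \<psi> where "has_exponent (distr M borel (Y 1)) \<psi>"
    "\<And>t u. 0 \<le> t \<Longrightarrow> (\<integral>\<omega>. iexp (u \<bullet> Y t \<omega>) \<partial>M) = exp (of_real t * \<psi> u)"
proof -
  interpret prob_space M using L by (simp add: levy_process_def)
  have meas[measurable]: "s \<ge> 0 \<Longrightarrow> Y s \<in> borel_measurable M" for s
    using L by (simp add: levy_process_def)
  have Y0: "\<omega> \<in> space M \<Longrightarrow> Y 0 \<omega> = 0" for \<omega> using L by (simp add: levy_process_def)
  define g where "g t u = (\<integral>\<omega>. iexp (u \<bullet> Y t \<omega>) \<partial>M)" for t u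
  have bound: "cmod (g t u) \<le> 1" if "0 \<le> t" for t u
  proof -
    have "cmod (g t u) \<le> (\<integral>\<omega>. cmod (iexp (u \<bullet> Y t \<omega>)) \<partial>M)" unfolding g_def by (rule integral_norm_bound)
    then show ?thesis by (simp add: prob_space)
  qed
  have g0: "g 0 u = 1" for u
  proof -
    have "g 0 u = (\<integral>\<omega>. 1 \<partial>M)" unfolding g_def by (rule Bochner_Integration.integral_cong) (auto simp: Y0)
    then show ?thesis by (simp add: prob_space)
  qed
  have gmult: "g (s + t) u = g s u * g t u" if "0 \<le> s" "0 \<le> t" for s t u
  proof -
    \<comment> \<open>The increments over \<open>[0, s]\<close> and \<open>[s, s + t]\<close>.\<close>
    let ?t = "\<lambda>i::nat. if i = 0 then 0 else if i = 1 then s else s + t"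
    have "(\<integral>\<omega>. (\<Prod>i<2. iexp (u \<bullet> (Y (?t (Suc i)) \<omega> - Y (?t i) \<omega>))) \<partial>M)
      = (\<Prod>i<2. \<integral>\<omega>. iexp (u \<bullet> Y (?t (Suc i) - ?t i) \<omega>) \<partial>M)"
      by (rule levy_increments_char[OF L]) (use that in auto)
    also have "\<dots> = g s u * g t u" by (simp add: g_def numeral_2_eq_2)
    also have "(\<integral>\<omega>. (\<Prod>i<2. iexp (u \<bullet> (Y (?t (Suc i)) \<omega> - Y (?t i) \<omega>))) \<partial>M) = g (s + t) u"
      unfolding g_def by (rule Bochner_Integration.integral_cong)
        (auto simp: numeral_2_eq_2 Y0 exp_add[symmetric] algebra_simps inner_diff_right)
    finally show ?thesis .
  qed
  have glim: "((\<lambda>t. g t u) \<longlongrightarrow> 1) (at_right 0)" for u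
  proof (rule tendsto_at_right_sequentially[of 0 1])
    fix S :: "nat \<Rightarrow> real" assume S: "\<And>n. 0 < S n" "S \<longlonglongrightarrow> 0"
    have Sr: "filterlim S (at_right 0) sequentially"
      using S(2) S(1)[THEN less_imp_neq, symmetric] S(1) by (simp add: filterlim_at)
    have "(\<lambda>n. g (S n) u) \<longlonglongrightarrow> (\<integral>\<omega>. 1 \<partial>M)"
      unfolding g_def
    proof (rule integral_dominated_convergence[where w="\<lambda>_. 1"])
      show "AE \<omega> in M. (\<lambda>n. iexp (u \<bullet> Y (S n) \<omega>)) \<longlonglongrightarrow> 1"
      proof (rule AE_I2)
        fix \<omega> assume w: "\<omega> \<in> space M"
        have "cadlag (\<lambda>t. Y t \<omega>)" using L w by (simp add: levy_process_def)
        then have "((\<lambda>t. Y t \<omega>) \<longlongrightarrow> Y 0 \<omega>) (at_right 0)" by (simp add: cadlag_def continuous_within)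
        from filterlim_compose[OF this Sr] have "(\<lambda>n. Y (S n) \<omega>) \<longlonglongrightarrow> 0" by (simp add: Y0 w)
        then have "(\<lambda>n. iexp (u \<bullet> Y (S n) \<omega>)) \<longlonglongrightarrow> iexp (u \<bullet> 0)"
          by (intro tendsto_intros)
        then show "(\<lambda>n. iexp (u \<bullet> Y (S n) \<omega>)) \<longlonglongrightarrow> 1" by simp
      qed
      have [measurable]: "Y (S n) \<in> borel_measurable M" for n using S(1)[of n] by (intro meas) simp
      show "(\<lambda>\<omega>. iexp (u \<bullet> Y (S n) \<omega>)) \<in> borel_measurable M" for n by measurable
    qed auto
    then show "(\<lambda>n. g (S n) u) \<longlonglongrightarrow> 1" by (simp add: prob_space)
  qed simp
  have "\<exists>c. \<forall>t\<ge>0. g t u = exp (of_real t * c)" for u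
    by (rule exp_semigroup) (use g0 gmult bound glim in auto)
  then obtain \<psi>0 where psi0: "\<And>t u. 0 \<le> t \<Longrightarrow> g t u = exp (of_real t * \<psi>0 u)" by metis
  have gcont: "continuous_on UNIV (g t)" if t: "0 \<le> t" for t
    unfolding continuous_on_sequentially comp_def
  proof (intro allI ballI impI, elim conjE)
    fix x :: "nat \<Rightarrow> 'a" and a assume x: "x \<longlonglongrightarrow> a"
    show "(\<lambda>n. g t (x n)) \<longlonglongrightarrow> g t a"
      unfolding g_def
      by (rule integral_dominated_convergence[where w="\<lambda>_. 1"])
        (use x t in \<open>auto intro!: AE_I2 tendsto_intros borel_measurable_inner\<close>)
  qed
  have c: "continuous_on UNIV \<psi>0"
  proof (rule continuous_exponent)
    fix t :: real assume t: "0 \<le> t"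
    have "(\<lambda>u. exp (of_real t * \<psi>0 u)) = g t" using psi0[OF t] by auto
    with gcont[OF t] show "continuous_on UNIV (\<lambda>u. exp (of_real t * \<psi>0 u))" by (simp only:)
    show "cmod (exp (of_real t * \<psi>0 u)) \<le> 1" for u using bound[OF t, of u] psi0[OF t, of u] by simp
  qed
  have "g t 0 = 1" for t by (simp add: g_def prob_space)
  then have z: "exp (of_real t * \<psi>0 0) = 1" if "0 \<le> t" for t using psi0[OF that, of 0] by simp
  have z0: "\<psi>0 0 = 0"
  proof -
    \<comment> \<open>The characteristic functions are 1 at 0 for all times \<open>t\<close>, not only for \<open>t = 1\<close>; this rules out a
      nonzero multiple of \<open>2 * pi * \<i>\<close>.\<close>
    have "integral {0..1} (\<lambda>t. exp (of_real t * \<psi>0 0)) = integral {0..1::real} (\<lambda>t. 1)"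
      by (rule Henstock_Kurzweil_Integration.integral_cong) (use z in auto)
    then show ?thesis using exp_semigroup_integral[of 1 "\<psi>0 0"] z[of 1] by simp
  qed
  show ?thesis
  proof (rule that[of \<psi>0])
    show "has_exponent (distr M borel (Y 1)) \<psi>0"
      using c z0 psi0[of 1] by (auto simp: has_exponent_def char_vec_distr g_def prob_space_distr)
    show "(\<integral>\<omega>. iexp (u \<bullet> Y t \<omega>) \<partial>M) = exp (of_real t * \<psi>0 u)" if "0 \<le> t" for t u
      using psi0[OF that] by (simp add: g_def)
  qed
qed

section \<open>Pathwise integrals of time-changed cadlag functions\<close>

text \<open>One-sided limits give a bound near each point, and finitely many such neighbourhoods cover the
  interval.\<close>

lemma cadlag_bounded:
  fixes y :: "real \<Rightarrow> 'a::euclidean_space"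
  assumes "cadlag y"
  shows "\<exists>B. \<forall>t\<in>{0..c}. norm (y t) \<le> B"
proof -
  have local_bound: "\<exists>B. \<forall>\<^sub>F s in F. norm (y s) \<le> B" if lim: "(y \<longlongrightarrow> l) F" for l F
  proof -
    have "\<forall>\<^sub>F s in F. dist (y s) l < 1" using tendstoD[OF lim, of 1] by simp
    then have "\<forall>\<^sub>F s in F. norm (y s) \<le> norm l + 1"
    proof eventually_elim
      case (elim s)
      then show ?case using norm_triangle_ineq2[of "y s" l] by (simp add: dist_norm)
    qed
    then show ?thesis by blast
  qed
  have "\<exists>U B. open U \<and> t \<in> U \<and> (\<forall>s\<in>U. 0 \<le> s \<longrightarrow> norm (y s) \<le> B)" if "t \<in> {0..c}" for t
  proof -
    have right: "\<exists>B. \<forall>\<^sub>F s in at_right t. norm (y s) \<le> B"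
    proof -
      have "(y \<longlongrightarrow> y t) (at_right t)" using assms that by (simp add: cadlag_def continuous_within)
      then show ?thesis by (rule local_bound)
    qed
    have left: "\<exists>B. \<forall>\<^sub>F s in at_left t. 0 \<le> s \<longrightarrow> norm (y s) \<le> B"
    proof (cases "t = 0")
      case True
      then show ?thesis by (auto simp: eventually_at_filter)
    next
      case False
      with that have "t > 0" by simp
      then obtain l where "(y \<longlongrightarrow> l) (at_left t)" using assms by (auto simp: cadlag_def)
      then obtain B where "\<forall>\<^sub>F s in at_left t. norm (y s) \<le> B" using local_bound by blast
      then show ?thesis by (intro exI[of _ B]) (auto elim!: eventually_mono)
    qed
    obtain B1 B2 where "\<forall>\<^sub>F s in at_right t. norm (y s) \<le> B1" "\<forall>\<^sub>F s in at_left t. 0 \<le> s \<longrightarrow> norm (y s) \<le> B2"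
      using left right by blast
    then have "\<forall>\<^sub>F s in at_right t. 0 \<le> s \<longrightarrow> norm (y s) \<le> max (norm (y t)) (max B1 B2)"
      "\<forall>\<^sub>F s in at_left t. 0 \<le> s \<longrightarrow> norm (y s) \<le> max (norm (y t)) (max B1 B2)"
      by (auto elim!: eventually_mono)
    then have "\<forall>\<^sub>F s in at t. 0 \<le> s \<longrightarrow> norm (y s) \<le> max (norm (y t)) (max B1 B2)"
      by (simp add: eventually_at_split)
    then have "\<forall>\<^sub>F s in nhds t. 0 \<le> s \<longrightarrow> norm (y s) \<le> max (norm (y t)) (max B1 B2)"
      unfolding eventually_at_filter by (rule eventually_mono) auto
    then show ?thesis unfolding eventually_nhds by blast
  qed
  then obtain U B where UB: "\<And>t. t \<in> {0..c} \<Longrightarrow> open (U t) \<and> t \<in> U t \<and> (\<forall>s\<in>U t. 0 \<le> s \<longrightarrow> norm (y s) \<le> B t)"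
    by metis
  obtain T where T: "T \<subseteq> {0..c}" "finite T" "{0..c} \<subseteq> (\<Union>t\<in>T. U t)"
    by (rule compactE_image[of "{0..c}" "{0..c}" U]) (use UB in auto)
  show ?thesis
  proof (intro exI ballI)
    fix t assume t: "t \<in> {0..c}"
    then obtain s where s: "s \<in> T" "t \<in> U s" using T by auto
    then have "norm (y t) \<le> B s" using UB[of s] t T by auto
    also have "\<dots> \<le> Max (B ` T)" using s T by simp
    finally show "norm (y t) \<le> Max (B ` T)" .
  qed
qed

text \<open>The sums are integrals of the step functions \<open>f (\<lceil>n t\<rceil> / n)\<close>. These converge pointwise to \<open>f t\<close>
  because \<open>\<lceil>n t\<rceil> / n\<close> approaches \<open>t\<close> from the right, so dominated convergence applies. Right end
  points are essential, as \<open>f\<close> is only right continuous.\<close>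

lemma right_Riemann_sums:
  fixes f :: "real \<Rightarrow> 'a::euclidean_space"
  assumes cont: "\<And>t. t \<in> {0..1} \<Longrightarrow> continuous (at t within {t..1}) f"
    and bound: "\<And>t. t \<in> {0..1} \<Longrightarrow> norm (f t) \<le> B"
  shows "f integrable_on {0..1}"
    and "(\<lambda>n. (1 / Suc n) *\<^sub>R (\<Sum>i<Suc n. f (Suc i / Suc n))) \<longlonglongrightarrow> integral {0..1} f"
proof -
  define g where "g n t = f (of_int \<lceil>t * real (Suc n)\<rceil> / real (Suc n))" for n :: nat and t
  have part: "(g n has_integral (1 / Suc n) *\<^sub>R (\<Sum>i<k. f (Suc i / Suc n))) {0..k / Suc n}" for n k
  proof (induction k)
    case 0
    then show ?case by (simp add: has_integral_refl)
  next
    case (Suc k)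
    let ?a = "k / Suc n" and ?b = "Suc k / Suc n"
    have ab: "?a \<le> ?b" by (simp add: divide_right_mono)
    have "((\<lambda>t. f (Suc k / Suc n)) has_integral (?b - ?a) *\<^sub>R f (Suc k / Suc n)) {?a..?b}"
      using has_integral_const_real[of "f (Suc k / Suc n)" ?a ?b] ab by simp
    then have "(g n has_integral (?b - ?a) *\<^sub>R f (Suc k / Suc n)) {?a..?b}"
    proof (rule has_integral_spike_finite[rotated 2, of _ _ _ "{?a}"])
      fix t assume t: "t \<in> {?a..?b} - {?a}"
      then have "\<lceil>t * real (Suc n)\<rceil> = int (Suc k)"
        by (intro ceiling_unique) (auto simp: field_simps)
      then show "g n t = f (Suc k / Suc n)" by (simp add: g_def)
    qed simp
    from has_integral_combine[OF _ ab Suc.IH this]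
    have "(g n has_integral (1 / Suc n) *\<^sub>R (\<Sum>i<k. f (Suc i / Suc n)) + (?b - ?a) *\<^sub>R f (Suc k / Suc n)) {0..?b}"
      by simp
    moreover have "?b - ?a = 1 / Suc n" by (simp add: field_simps)
    ultimately show ?case by (simp only: sum.lessThan_Suc scaleR_add_right)
  qed
  have g: "(g n has_integral (1 / Suc n) *\<^sub>R (\<Sum>i<Suc n. f (Suc i / Suc n))) {0..1}" for n
    using part[of n "Suc n"] by simp
  have mem: "of_int \<lceil>t * real (Suc n)\<rceil> / Suc n \<in> {t..1}" "of_int \<lceil>t * real (Suc n)\<rceil> / Suc n \<le> t + 1 / Suc n" if "t \<in> {0..1}" for t and n :: nat
  proof -
    define N where "N = real (Suc n)"
    have N: "N > 0" by (simp add: N_def)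
    have "\<lceil>t * N\<rceil> \<le> int (Suc n)" using that by (intro ceiling_le) (simp add: mult_left_le_one_le N_def)
    then have "real_of_int \<lceil>t * N\<rceil> \<le> N" unfolding N_def by linarith
    moreover have "t * N \<le> of_int \<lceil>t * N\<rceil>" "of_int \<lceil>t * N\<rceil> \<le> t * N + 1" by linarith+
    ultimately show "of_int \<lceil>t * real (Suc n)\<rceil> / Suc n \<in> {t..1}" "of_int \<lceil>t * real (Suc n)\<rceil> / Suc n \<le> t + 1 / Suc n"
      unfolding N_def[symmetric] using N by (simp_all add: field_simps)
  qed
  have lim: "(\<lambda>n. g n t) \<longlonglongrightarrow> f t" if t: "t \<in> {0..1}" for t
  proof -
    have "(\<lambda>n. of_int \<lceil>t * real (Suc n)\<rceil> / Suc n) \<longlonglongrightarrow> t"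
    proof (rule tendsto_sandwich[of "\<lambda>_. t" _ _ "\<lambda>n. t + 1 / Suc n"])
      show "(\<lambda>n. t + 1 / real (Suc n)) \<longlonglongrightarrow> t"
        using tendsto_add[OF tendsto_const LIMSEQ_Suc[OF lim_1_over_n], of t] by simp
    qed (use mem[OF t] in auto)
    then show ?thesis
      using cont[OF t, unfolded continuous_within_sequentially comp_def, rule_format,
          of "\<lambda>n. of_int \<lceil>t * real (Suc n)\<rceil> / Suc n"] mem(1)[OF t]
      unfolding g_def by simp
  qed
  have "f integrable_on {0..1} \<and> (\<lambda>n. integral {0..1} (g n)) \<longlonglongrightarrow> integral {0..1} f"
  proof (intro conjI)
    have b: "norm (g n t) \<le> B" if "t \<in> {0..1}" for n t
      unfolding g_def using mem(1)[OF that, of n] that by (intro bound) auto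
    show "f integrable_on {0..1}"
      by (rule dominated_convergence(1)[where f=g and h="\<lambda>_. B"]) (use g b lim in \<open>auto simp: integrable_on_def\<close>)
    show "(\<lambda>n. integral {0..1} (g n)) \<longlonglongrightarrow> integral {0..1} f"
      by (rule dominated_convergence(2)[where f=g and h="\<lambda>_. B"]) (use g b lim in \<open>auto simp: integrable_on_def\<close>)
  qed
  then show "f integrable_on {0..1}" "(\<lambda>n. (1 / Suc n) *\<^sub>R (\<Sum>i<Suc n. f (Suc i / Suc n))) \<longlonglongrightarrow> integral {0..1} f"
    by (auto simp: integral_unique[OF g])
qed

lemma stieltjes_integral_eqI: "has_stieltjes_integral f h a b I \<Longrightarrow> stieltjes_integral f h a b = I"
  unfolding stieltjes_integral_def using has_stieltjes_integral_unique by blast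

text \<open>Summation by parts: the Riemann sums of the integral in the definition become sums of increments
  of the time-changed path, whose law is accessible for a Levy process.\<close>

lemma path_integral_ident_limit:
  fixes y :: "real \<Rightarrow> 'a::euclidean_space"
  assumes y: "cadlag y"
    and r: "mono_on {0..1} r" "\<And>t. t \<in> {0..1} \<Longrightarrow> continuous (at t within {t..1}) r" "0 \<le> r 0"
  shows "(\<lambda>t. y (r t)) integrable_on {0..1}"
    and "path_integral 0 1 (\<lambda>t. t) r y = y (r 1) - integral {0..1} (\<lambda>t. y (r t))"
    and "(\<lambda>n. \<Sum>i<Suc n. (i / Suc n) *\<^sub>R (y (r (Suc i / Suc n)) - y (r (i / Suc n))))
        \<longlonglongrightarrow> path_integral 0 1 (\<lambda>t. t) r y"
proof -
  have rb: "0 \<le> r t \<and> r t \<le> r 1" if "t \<in> {0..1}" for t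
    using mono_onD[OF r(1), of 0 t] mono_onD[OF r(1), of t 1] that r(3) by auto
  obtain B where B: "\<And>t. t \<in> {0..r 1} \<Longrightarrow> norm (y t) \<le> B" using cadlag_bounded[OF y] by blast
  have cont: "continuous (at t within {t..1}) (\<lambda>t. y (r t))" if t: "t \<in> {0..1}" for t
  proof -
    have "continuous (at_right (r t)) y" using y rb[OF t] by (simp add: cadlag_def)
    then have "continuous (at (r t) within {r t..}) y"
      by (simp add: continuous_within at_within_Ici_at_right)
    moreover have "r ` {t..1} \<subseteq> {r t..}" using mono_onD[OF r(1), of t] t by auto
    ultimately have "continuous (at (r t) within r ` {t..1}) y" by (rule continuous_within_subset)
    from continuous_within_compose[OF r(2)[OF t] this] show ?thesis by (simp add: comp_def)
  qed
  note R = right_Riemann_sums[OF cont, of B]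
  show int: "(\<lambda>t. y (r t)) integrable_on {0..1}"
    by (rule R) (use B rb in auto)
  then have "has_stieltjes_integral (\<lambda>t. y (r t)) (\<lambda>t. t) 0 1 (integral {0..1} (\<lambda>t. y (r t)))"
    by (simp add: has_stieltjes_integral_ident_iff integrable_integral)
  then show eq: "path_integral 0 1 (\<lambda>t. t) r y = y (r 1) - integral {0..1} (\<lambda>t. y (r t))"
    by (simp add: path_integral_def stieltjes_integral_eqI)
  have "(\<lambda>n. (1 / Suc n) *\<^sub>R (\<Sum>i<Suc n. y (r (Suc i / Suc n)))) \<longlonglongrightarrow> integral {0..1} (\<lambda>t. y (r t))"
    by (rule R) (use B rb in auto)
  from tendsto_diff[OF tendsto_const[of "y (r 1)"] this]
  have lim: "(\<lambda>n. y (r 1) - (1 / Suc n) *\<^sub>R (\<Sum>i<Suc n. y (r (Suc i / Suc n)))) \<longlonglongrightarrow> path_integral 0 1 (\<lambda>t. t) r y"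
    by (simp add: eq)
  have parts: "(\<Sum>i<k. (i / Suc n) *\<^sub>R (y (r (Suc i / Suc n)) - y (r (i / Suc n))))
      = (k / Suc n) *\<^sub>R y (r (k / Suc n)) - (1 / Suc n) *\<^sub>R (\<Sum>i<k. y (r (Suc i / Suc n)))" for n k
  proof (induction k)
    case (Suc k)
    have "real (Suc k) / Suc n = k / Suc n + 1 / Suc n" by (simp add: field_simps)
    then have *: "(real (Suc k) / Suc n) *\<^sub>R z = (k / Suc n) *\<^sub>R z + (1 / Suc n) *\<^sub>R z" for z :: 'a
      by (simp only: scaleR_add_left)
    show ?case unfolding sum.lessThan_Suc Suc.IH * by (simp add: algebra_simps)
  qed simp
  show "(\<lambda>n. \<Sum>i<Suc n. (i / Suc n) *\<^sub>R (y (r (Suc i / Suc n)) - y (r (i / Suc n))))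
        \<longlonglongrightarrow> path_integral 0 1 (\<lambda>t. t) r y"
    unfolding parts using lim by simp
qed

text \<open>The homeomorphism \<open>g\<close> carries tagged divisions of the unit interval to tagged divisions, and
  the increment of \<open>g\<close> over a cell is the length of its image. So Stieltjes sums for \<open>f\<close> are ordinary
  gauge sums for \<open>f \<circ> h\<close>, where \<open>h\<close> is the inverse of \<open>g\<close>.\<close>

lemma has_stieltjes_integral_substitution:
  fixes f :: "real \<Rightarrow> 'a::euclidean_space" and g h :: "real \<Rightarrow> real"
  assumes g: "mono_on {0..1} g" "continuous_on {0..1} g" "\<And>t. t \<in> {0..1} \<Longrightarrow> g t \<in> {0..1}"
    and h: "mono_on {0..1} h" "\<And>s. s \<in> {0..1} \<Longrightarrow> h s \<in> {0..1}"
    and inv: "\<And>s. s \<in> {0..1} \<Longrightarrow> g (h s) = s" "\<And>t. t \<in> {0..1} \<Longrightarrow> h (g t) = t"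
    and f: "((\<lambda>s. f (h s)) has_integral I) {0..1}"
  shows "has_stieltjes_integral f g 0 1 I"
  unfolding has_stieltjes_integral_def tendsto_iff
proof (intro allI impI)
  fix e :: real assume "e > 0"
  then obtain \<gamma> where \<gamma>: "gauge \<gamma>"
    "\<And>D. D tagged_division_of {0..1} \<Longrightarrow> \<gamma> fine D \<Longrightarrow> norm ((\<Sum>(x,K)\<in>D. measure lborel K *\<^sub>R f (h x)) - I) < e"
    using f unfolding has_integral_real by metis
  have inj: "inj_on g {0..1}" using inv(2) by (metis inj_onI)
  have image: "g ` {a..b} = {g a..g b}" "g ` {a<..<b} = {g a<..<g b}" "g a \<le> g b" if ab: "0 \<le> a" "a \<le> b" "b \<le> 1" for a b
  proof -
    have mem: "a \<in> {0..1}" "b \<in> {0..1}" using ab by auto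
    have gab: "g a \<in> {0..1}" "g b \<in> {0..1}" using g(3) mem by auto
    show "g ` {a..b} = {g a..g b}"
    proof (intro equalityI subsetI)
      fix s assume "s \<in> g ` {a..b}"
      then show "s \<in> {g a..g b}" using ab by (auto intro!: mono_onD[OF g(1)])
    next
      fix s assume s: "s \<in> {g a..g b}"
      then have "s \<in> {0..1}" "a \<le> h s" "h s \<le> b"
        using gab mono_onD[OF h(1), of "g a" s] mono_onD[OF h(1), of s "g b"] inv(2) mem by auto
      then show "s \<in> g ` {a..b}" using inv(1) by (intro image_eqI[of _ _ "h s"]) auto
    qed
    then have "g ` ({a..b} - {a, b}) = {g a..g b} - {g a, g b}"
      using inj ab by (subst inj_on_image_set_diff[OF inj]) auto
    moreover have "{a..b} - {a, b} = {a<..<b}" "{g a..g b} - {g a, g b} = {g a<..<g b}" by auto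
    ultimately show "g ` {a<..<b} = {g a<..<g b}" by simp
    show "g a \<le> g b" using ab mem by (intro mono_onD[OF g(1)])
  qed
  \<comment> \<open>Gauges consist of open subsets of the line, so preimages are taken under a continuous
    extension of \<open>g\<close> beyond the unit interval.\<close>
  define G where "G z = g (max 0 (min 1 z))" for z
  have G: "continuous_on UNIV G"
    unfolding G_def by (rule continuous_on_compose2[OF g(2)]) (auto intro!: continuous_intros)
  have Gg: "G z = g z" if "z \<in> {0..1}" for z using that by (simp add: G_def)
  define \<gamma>' where "\<gamma>' x = G -` \<gamma> (G x)" for x
  have gauge: "gauge \<gamma>'"
    using \<gamma>(1) open_vimage[OF _ G] by (auto simp: gauge_def \<gamma>'_def)
  have close: "dist (\<Sum>(x, K)\<in>p. (g (Sup K) - g (Inf K)) *\<^sub>R f x) I < e"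
    if p: "p tagged_division_of {0..1}" "\<gamma>' fine p" for p
  proof -
    let ?m = "\<lambda>(x, K). (g x, g ` K)"
    have pK: "\<exists>a b. K = {a..b} \<and> 0 \<le> a \<and> a \<le> b \<and> b \<le> 1 \<and> x \<in> {a..b}" if xK: "(x, K) \<in> p" for x K
    proof -
      obtain a b where K: "K = {a..b}" using tagged_division_ofD(4)[OF p(1) xK] by (auto simp: box_real)
      moreover have "x \<in> K" "K \<subseteq> {0..1}" using tagged_division_ofD(2,3)[OF p(1) xK] by auto
      ultimately show ?thesis by (intro exI[of _ a] exI[of _ b]) auto
    qed
    have injm: "inj_on ?m p"
    proof (rule inj_onI, clarify)
      fix x K x' K' assume a: "(x, K) \<in> p" "(x', K') \<in> p" "g x = g x'" "g ` K = g ` K'"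
      have "K \<subseteq> {0..1}" "K' \<subseteq> {0..1}" "x \<in> {0..1}" "x' \<in> {0..1}"
        using tagged_division_ofD(2,3)[OF p(1) a(1)] tagged_division_ofD(2,3)[OF p(1) a(2)] by auto
      then show "x = x' \<and> K = K'" using a inj by (metis inj_on_eq_iff inj_on_image_eq_iff)
    qed
    have td: "(?m ` p) tagged_division_of {0..1}"
    proof (rule tagged_division_ofI)
      show "finite (?m ` p)" using tagged_division_ofD(1)[OF p(1)] by simp
    next
      fix y L assume "(y, L) \<in> ?m ` p"
      then obtain x K where xK: "(x, K) \<in> p" "y = g x" "L = g ` K" by auto
      then obtain a b where ab: "K = {a..b}" "0 \<le> a" "a \<le> b" "b \<le> 1" "x \<in> {a..b}" using pK by blast
      show "y \<in> L" using xK ab by auto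
      show "L \<subseteq> {0..1}" using xK ab g(3) by force
      show "\<exists>a b. L = cbox a b" using xK ab image(1) by (auto simp: box_real)
    next
      fix y L y' L' assume L: "(y, L) \<in> ?m ` p" and L': "(y', L') \<in> ?m ` p" and ne: "(y, L) \<noteq> (y', L')"
      from L obtain x K where xK: "(x, K) \<in> p" "y = g x" "L = g ` K" by auto
      from L' obtain x' K' where xK': "(x', K') \<in> p" "y' = g x'" "L' = g ` K'" by auto
      obtain a b where ab: "K = {a..b}" "0 \<le> a" "a \<le> b" "b \<le> 1" using pK[OF xK(1)] by blast
      obtain a' b' where ab': "K' = {a'..b'}" "0 \<le> a'" "a' \<le> b'" "b' \<le> 1" using pK[OF xK'(1)] by blast
      have "(x, K) \<noteq> (x', K')" using ne xK xK' by auto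
      then have "interior K \<inter> interior K' = {}"
        using tagged_division_ofD(5)[OF p(1) xK(1) xK'(1)] by simp
      then have disj: "{a<..<b} \<inter> {a'<..<b'} = {}" using ab(1) ab'(1) by simp
      have "interior L \<inter> interior L' = g ` {a<..<b} \<inter> g ` {a'<..<b'}"
        using xK xK' ab ab' image by simp
      also have "\<dots> = g ` ({a<..<b} \<inter> {a'<..<b'})"
        by (rule inj_on_image_Int[OF inj, symmetric]) (use ab ab' in auto)
      finally show "interior L \<inter> interior L' = {}" using disj by simp
    next
      have "\<Union>{L. \<exists>y. (y, L) \<in> ?m ` p} = g ` \<Union>{K. \<exists>x. (x, K) \<in> p}" by (auto 0 3)
      also have "\<dots> = g ` {0..1}" by (simp only: tagged_division_ofD(6)[OF p(1)])
      also have "\<dots> = {0..1}"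
      proof (intro equalityI subsetI)
        show "s \<in> g ` {0..1}" if "s \<in> {0..1}" for s using inv(1)[OF that] h(2)[OF that] by (metis imageI)
        show "s \<in> {0..1}" if "s \<in> g ` {0..1}" for s using that g(3) by blast
      qed
      finally show "\<Union>{L. \<exists>y. (y, L) \<in> ?m ` p} = {0..1}" .
    qed
    have fine: "\<gamma> fine (?m ` p)"
    proof (rule fineI, clarify)
      fix x K z assume xK: "(x, K) \<in> p" and z: "z \<in> K"
      have "K \<subseteq> {0..1}" "x \<in> K" using tagged_division_ofD(2,3)[OF p(1) xK] by auto
      then have "x \<in> {0..1}" "z \<in> {0..1}" using z by auto
      moreover have "z \<in> \<gamma>' x" using fineD[OF p(2) xK] z by auto
      ultimately show "g z \<in> \<gamma> (g x)" using Gg by (simp add: \<gamma>'_def)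
    qed
    have "(\<Sum>(y, L)\<in>?m ` p. measure lborel L *\<^sub>R f (h y)) = (\<Sum>(x, K)\<in>p. measure lborel (g ` K) *\<^sub>R f (h (g x)))"
      by (subst sum.reindex[OF injm]) (simp add: case_prod_beta)
    also have "\<dots> = (\<Sum>(x, K)\<in>p. (g (Sup K) - g (Inf K)) *\<^sub>R f x)"
    proof (rule sum.cong[OF refl], clarify)
      fix x K assume "(x, K) \<in> p"
      then obtain a b where ab: "K = {a..b}" "0 \<le> a" "a \<le> b" "b \<le> 1" "x \<in> {a..b}" using pK by blast
      then show "measure lborel (g ` K) *\<^sub>R f (h (g x)) = (g (Sup K) - g (Inf K)) *\<^sub>R f x"
        using image[of a b] inv(2)[of x] by auto
    qed
    finally show ?thesis using \<gamma>(2)[OF td fine] by (simp add: dist_norm)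
  qed
  show "\<forall>\<^sub>F p in division_filter {0..1}. dist (\<Sum>(x, K)\<in>p. (g (Sup K) - g (Inf K)) *\<^sub>R f x) I < e"
    unfolding eventually_division_filter using gauge close by (intro exI[of _ \<gamma>'] conjI allI impI) simp_all
qed

text \<open>The power can be moved from the integrand to the clock: both sides, pathwise, are \<open>Y 1\<close> minus the
  integral of \<open>Y (t powr \<beta>)\<close> over the unit interval.\<close>

lemma J_map_eq_time_change:
  assumes L: "levy_process (P \<nu>) (Y \<nu>)" and b: "\<beta> > 0"
  shows "J_map P Y \<beta> \<nu> = random_integral_law 0 1 (\<lambda>t. t) (\<lambda>t. t powr \<beta>) (P \<nu>) (Y \<nu>)"
  unfolding J_map_def random_integral_law_def
proof (rule distr_cong[OF refl refl])
  fix \<omega> assume "\<omega> \<in> space (P \<nu>)"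
  then have y: "cadlag (\<lambda>t. Y \<nu> t \<omega>)" using L by (simp add: levy_process_def)
  let ?y = "\<lambda>t. Y \<nu> t \<omega>"
  have cont: "continuous (at t within {t..1}) (\<lambda>t. t powr \<beta>)" if "t \<in> {0..1}" for t
  proof -
    have "continuous_on {0..1} (\<lambda>t. t powr \<beta>)" using b by (intro continuous_on_powr') (auto intro!: continuous_intros)
    then have "continuous (at t within {0..1}) (\<lambda>t. t powr \<beta>)" using that by (simp add: continuous_on_eq_continuous_within)
    then show ?thesis by (rule continuous_within_subset) (use that in auto)
  qed
  have mono: "mono_on {0..1} (\<lambda>t. t powr b)" if "b > 0" for b :: real
    using that by (intro mono_onI) (simp add: powr_mono2)
  note p = path_integral_ident_limit[OF y mono[OF b] cont]
  have "has_stieltjes_integral ?y (\<lambda>t. t powr (1 / \<beta>)) 0 1 (integral {0..1} (\<lambda>t. ?y (t powr \<beta>)))"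
  proof (rule has_stieltjes_integral_substitution[where h="\<lambda>t. t powr \<beta>"])
    show "continuous_on {0..1} (\<lambda>t. t powr (1 / \<beta>))"
      using b by (intro continuous_on_powr') (auto intro!: continuous_intros)
    show "((\<lambda>s. ?y (s powr \<beta>)) has_integral integral {0..1} (\<lambda>t. ?y (t powr \<beta>))) {0..1}"
      using p(1) b by (simp add: integrable_integral)
  qed (use b mono in \<open>auto simp: powr_powr powr_le1\<close>)
  then have "path_integral 0 1 (\<lambda>t. t powr (1 / \<beta>)) (\<lambda>t. t) ?y = ?y 1 - integral {0..1} (\<lambda>t. ?y (t powr \<beta>))"
    by (simp add: path_integral_def stieltjes_integral_eqI)
  also have "\<dots> = path_integral 0 1 (\<lambda>t. t) (\<lambda>t. t powr \<beta>) ?y"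
    using p(2) b by simp
  finally show "path_integral 0 1 (\<lambda>t. t powr (1 / \<beta>)) (\<lambda>t. t) ?y = path_integral 0 1 (\<lambda>t. t) (\<lambda>t. t powr \<beta>) ?y" .
qed

section \<open>The law of a random integral\<close>

lemma exponent_mean_continuous:
  fixes \<psi> :: "'a::euclidean_space \<Rightarrow> complex"
  assumes N: "prob_space N" and [measurable]: "V \<in> borel_measurable N"
    and V: "AE \<omega> in N. 0 < V \<omega> \<and> V \<omega> \<le> 1" and psi: "continuous_on UNIV \<psi>"
  shows "continuous_on UNIV (\<lambda>u. \<integral>\<omega>. \<psi> (V \<omega> *\<^sub>R u) \<partial>N)"
  unfolding continuous_on_sequentially comp_def
proof (intro allI ballI impI, elim conjE)
  interpret prob_space N by fact
  have [measurable]: "\<psi> \<in> borel_measurable borel" using psi by (rule borel_measurable_continuous_onI)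
  fix x :: "nat \<Rightarrow> 'a" and a assume x: "x \<longlonglongrightarrow> a"
  then obtain R where R: "\<And>n. norm (x n) \<le> R" using convergent_imp_Bseq[of x] by (auto simp: convergent_def Bseq_def)
  have "bounded (\<psi> ` cball 0 R)"
    by (intro compact_imp_bounded compact_continuous_image continuous_on_subset[OF psi]) auto
  then obtain B where B: "\<And>v. norm v \<le> R \<Longrightarrow> cmod (\<psi> v) \<le> B"
    unfolding bounded_iff by (metis imageI mem_cball_0)
  show "(\<lambda>n. \<integral>\<omega>. \<psi> (V \<omega> *\<^sub>R x n) \<partial>N) \<longlonglongrightarrow> (\<integral>\<omega>. \<psi> (V \<omega> *\<^sub>R a) \<partial>N)"
  proof (rule integral_dominated_convergence[where w="\<lambda>_. B"])
    show "AE \<omega> in N. (\<lambda>n. \<psi> (V \<omega> *\<^sub>R x n)) \<longlonglongrightarrow> \<psi> (V \<omega> *\<^sub>R a)"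
      by (intro AE_I2 continuous_on_tendsto_compose[OF psi] tendsto_intros x) auto
    show "AE \<omega> in N. cmod (\<psi> (V \<omega> *\<^sub>R x n)) \<le> B" for n
      using V
    proof eventually_elim
      case (elim \<omega>)
      have "norm (V \<omega> *\<^sub>R x n) \<le> 1 * R" unfolding norm_scaleR using elim R[of n] by (intro mult_mono) auto
      then show ?case by (intro B) simp
    qed
  qed auto
qed

lemma distribution_function_right_continuous:
  fixes V :: "'u \<Rightarrow> real"
  assumes "prob_space N" and [measurable]: "V \<in> borel_measurable N"
  shows "continuous (at t within {t..}) (\<lambda>t. measure N {\<omega> \<in> space N. V \<omega> \<le> t})"
proof -
  interpret prob_space N by fact
  interpret d: real_distribution "distr N borel V" by (rule real_distribution_distr) simp
  have "cdf (distr N borel V) s = measure N {\<omega> \<in> space N. V \<omega> \<le> s}" for s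
    by (auto simp: cdf_def measure_distr intro!: arg_cong[where f="measure N"])
  then have "(\<lambda>t. measure N {\<omega> \<in> space N. V \<omega> \<le> t}) = cdf (distr N borel V)" by auto
  then show ?thesis
    using d.cdf_is_right_cont[of t] by (simp add: continuous_within at_within_Ici_at_right)
qed

text \<open>The integrand rounds \<open>V\<close> down to the grid of mesh \<open>1/n\<close>: it equals \<open>\<psi> (i/n)\<close> on the event
  \<open>i/n < V \<le> (i+1)/n\<close>, whose probability is an increment of the distribution function. So a
  Riemann-Stieltjes sum against \<open>F\<close> is an expectation.\<close>

lemma mean_of_steps:
  fixes \<psi> :: "real \<Rightarrow> complex" and V :: "'u \<Rightarrow> real"
  assumes N: "prob_space N" and [measurable]: "V \<in> borel_measurable N"
    and V: "AE \<omega> in N. 0 < V \<omega> \<and> V \<omega> \<le> 1"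
    and F: "\<And>t. F t = measure N {\<omega> \<in> space N. V \<omega> \<le> t}"
  shows "(\<integral>\<omega>. \<psi> ((of_int \<lceil>V \<omega> * Suc n\<rceil> - 1) / Suc n) \<partial>N)
     = (\<Sum>i<Suc n. of_real (F (Suc i / Suc n) - F (i / Suc n)) * \<psi> (i / Suc n))"
proof -
  interpret prob_space N by fact
  let ?A = "\<lambda>i. {\<omega> \<in> space N. i / Suc n < V \<omega> \<and> V \<omega> \<le> Suc i / Suc n}"
  have A: "measure N (?A i) = F (Suc i / Suc n) - F (i / Suc n)" for i
  proof -
    have "?A i = {\<omega> \<in> space N. V \<omega> \<le> Suc i / Suc n} - {\<omega> \<in> space N. V \<omega> \<le> i / Suc n}" by auto
    also have "measure N \<dots> = F (Suc i / Suc n) - F (i / Suc n)"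
      unfolding F using order_trans[OF _ divide_right_mono[of i "Suc i" "Suc n"]]
      by (intro finite_measure_Diff) auto
    finally show ?thesis .
  qed
  have "(\<integral>\<omega>. \<psi> ((of_int \<lceil>V \<omega> * Suc n\<rceil> - 1) / Suc n) \<partial>N)
      = (\<integral>\<omega>. (\<Sum>i<Suc n. indicator (?A i) \<omega> * \<psi> (i / Suc n)) \<partial>N)"
  proof (rule integral_cong_AE)
    have [measurable]: "(\<lambda>k::int. \<psi> ((of_int k - 1) / Suc n)) \<in> measurable (count_space UNIV) borel" by simp
    show "(\<lambda>\<omega>. \<psi> ((of_int \<lceil>V \<omega> * Suc n\<rceil> - 1) / Suc n)) \<in> borel_measurable N" by measurable
    show "AE \<omega> in N. \<psi> ((of_int \<lceil>V \<omega> * Suc n\<rceil> - 1) / Suc n) = (\<Sum>i<Suc n. indicator (?A i) \<omega> * \<psi> (i / Suc n))"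
      using V AE_space
    proof eventually_elim
      case (elim \<omega>)
      define k where "k = nat (\<lceil>V \<omega> * Suc n\<rceil> - 1)"
      define S where "S = real (Suc n)"
      have S: "S > 0" by (simp add: S_def)
      have pos: "0 < V \<omega> * S" using elim S by simp
      have "V \<omega> * S \<le> S" using elim S by (simp add: mult_left_le_one_le)
      then have "\<lceil>V \<omega> * S\<rceil> \<le> int (Suc n)" by (intro ceiling_le) (simp add: S_def)
      moreover have "1 \<le> \<lceil>V \<omega> * S\<rceil>" using pos by linarith
      ultimately have k: "int k = \<lceil>V \<omega> * S\<rceil> - 1" "k < Suc n" by (auto simp: k_def S_def)
      have iff: "\<omega> \<in> ?A i \<longleftrightarrow> i = k" for i :: nat
      proof -
        have "\<omega> \<in> ?A i \<longleftrightarrow> real i < V \<omega> * S \<and> V \<omega> * S \<le> real i + 1"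
          using elim S unfolding S_def[symmetric] by (auto simp: field_simps)
        also have "\<dots> \<longleftrightarrow> \<lceil>V \<omega> * S\<rceil> = int i + 1" by (auto simp: ceiling_eq_iff)
        also have "\<dots> \<longleftrightarrow> i = k" using k by auto
        finally show ?thesis .
      qed
      have "(\<Sum>i<Suc n. indicator (?A i) \<omega> * \<psi> (i / Suc n)) = (\<Sum>i<Suc n. if i = k then \<psi> (k / Suc n) else 0)"
        by (rule sum.cong) (auto simp only: iff indicator_def of_bool_def mult_1 mult_zero_left split: if_split)
      also have "\<dots> = \<psi> (k / Suc n)" using k(2) by simp
      also have "real k = of_int \<lceil>V \<omega> * Suc n\<rceil> - 1" using k(1) unfolding S_def by linarith
      finally show ?case by simp
    qed
    show "(\<lambda>\<omega>. \<Sum>i<Suc n. indicator (?A i) \<omega> * \<psi> (i / Suc n)) \<in> borel_measurable N"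
      by (intro borel_measurable_sum borel_measurable_times borel_measurable_indicator borel_measurable_const) measurable
  qed
  also have "\<dots> = (\<Sum>i<Suc n. (\<integral>\<omega>. indicator (?A i) \<omega> * \<psi> (i / Suc n) \<partial>N))"
  proof (rule Bochner_Integration.integral_sum)
    show "integrable N (\<lambda>\<omega>. indicator (?A i) \<omega> * \<psi> (i / Suc n))" for i
      by (rule integrable_bounded_prob[OF N, where B="cmod (\<psi> (i / Suc n))"])
        (measurable, simp add: norm_mult indicator_def)
  qed
  also have "\<dots> = (\<Sum>i<Suc n. of_real (measure N (?A i)) * \<psi> (i / Suc n))"
  proof (rule sum.cong[OF refl])
    fix i
    have "(\<integral>\<omega>. indicator (?A i) \<omega> * \<psi> (i / Suc n) \<partial>N)
        = (\<integral>\<omega>. complex_of_real (indicator (?A i) \<omega>) * \<psi> (i / Suc n) \<partial>N)"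
      by (rule Bochner_Integration.integral_cong) (simp_all add: indicator_def)
    also have "\<dots> = (\<integral>\<omega>. complex_of_real (indicator (?A i) \<omega>) \<partial>N) * \<psi> (i / Suc n)"
      by (rule integral_mult_left_zero)
    also have "(\<integral>\<omega>. complex_of_real (indicator (?A i) \<omega>) \<partial>N) = of_real (measure N (?A i))"
      by (simp only: integral_complex_of_real) (simp add: Int_def conj_ac cong: conj_cong)
    finally show "(\<integral>\<omega>. indicator (?A i) \<omega> * \<psi> (i / Suc n) \<partial>N) = of_real (measure N (?A i)) * \<psi> (i / Suc n)" .
  qed
  finally show ?thesis by (simp only: A)
qed

text \<open>The approximating sums have independent summands, so their exponents add up to a
  Riemann-Stieltjes sum, which is \<open>c\<close> times the mean of \<open>\<psi> (V u)\<close> with \<open>V\<close> rounded down to the grid.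
  The factor \<open>c\<close> serves to construct convolution roots.\<close>

theorem random_integral_exponent:
  fixes Y :: "real \<Rightarrow> 'w \<Rightarrow> 'a::euclidean_space"
  assumes L: "levy_process M Y"
    and psi: "continuous_on UNIV \<psi>" "\<psi> 0 = 0"
    and exp: "\<And>t u. 0 \<le> t \<Longrightarrow> (\<integral>\<omega>. iexp (u \<bullet> Y t \<omega>) \<partial>M) = exp (of_real t * \<psi> u)"
    and N: "prob_space N" and V: "V \<in> borel_measurable N" "AE \<omega> in N. 0 < V \<omega> \<and> V \<omega> \<le> 1"
    and r: "\<And>t. t \<in> {0..1} \<Longrightarrow> r t = c * measure N {\<omega> \<in> space N. V \<omega> \<le> t}" and c: "0 \<le> c"
  shows "has_exponent (random_integral_law 0 1 (\<lambda>t. t) r M Y) (\<lambda>u. of_real c * (\<integral>\<omega>. \<psi> (V \<omega> *\<^sub>R u) \<partial>N))"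
proof -
  interpret prob_space M using L by (simp add: levy_process_def)
  interpret N: prob_space N by fact
  note [measurable] = V(1)
  have [measurable]: "\<psi> \<in> borel_measurable borel" using psi(1) by (rule borel_measurable_continuous_onI)
  have meas: "s \<ge> 0 \<Longrightarrow> Y s \<in> borel_measurable M" for s
    using L by (simp add: levy_process_def)
  define F where "F t = measure N {\<omega> \<in> space N. V \<omega> \<le> t}" for t
  have Fmono: "F s \<le> F t" if "s \<le> t" for s t
    unfolding F_def using that by (intro N.finite_measure_mono) auto
  have r0: "0 \<le> r t" if "t \<in> {0..1}" for t using r[OF that] c by simp
  have rmono: "mono_on {0..1} r"
    using Fmono c by (intro mono_onI) (simp add: r F_def[symmetric] mult_left_mono)
  have rcont: "continuous (at t within {t..1}) r" if t: "t \<in> {0..1}" for t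
  proof -
    have "continuous (at t within {t..1}) (\<lambda>t. c * F t)"
      unfolding F_def
      by (intro continuous_intros continuous_within_subset[OF distribution_function_right_continuous[OF N V(1)]]) auto
    then show ?thesis
      by (rule continuous_transform_within[OF _ zero_less_one]) (use t r in \<open>auto simp: F_def\<close>)
  qed
  define X where "X n \<omega> = (\<Sum>i<Suc n. (i / Suc n) *\<^sub>R (Y (r (Suc i / Suc n)) \<omega> - Y (r (i / Suc n)) \<omega>))" for n \<omega>
  define Z where "Z \<omega> = path_integral 0 1 (\<lambda>t. t) r (\<lambda>t. Y t \<omega>)" for \<omega>
  have lim: "(\<lambda>n. X n \<omega>) \<longlonglongrightarrow> Z \<omega>" if "\<omega> \<in> space M" for \<omega>
    unfolding X_def Z_def
    by (rule path_integral_ident_limit) (use L that rmono rcont r0 in \<open>auto simp: levy_process_def\<close>)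
  have X[measurable]: "X n \<in> borel_measurable M" for n
    unfolding X_def
    by (intro borel_measurable_sum borel_measurable_scaleR borel_measurable_diff meas r0) auto
  have Z[measurable]: "Z \<in> borel_measurable M"
    by (rule borel_measurable_LIMSEQ_metric[OF X lim])
  define E where "E u = of_real c * (\<integral>\<omega>. \<psi> (V \<omega> *\<^sub>R u) \<partial>N)" for u
  have charX: "(\<integral>\<omega>. iexp (u \<bullet> X n \<omega>) \<partial>M)
      = exp (of_real c * (\<integral>\<omega>. \<psi> (((of_int \<lceil>V \<omega> * Suc n\<rceil> - 1) / Suc n) *\<^sub>R u) \<partial>N))" for n u
  proof -
    have ri: "0 \<le> r (Suc i / Suc n) - r (i / Suc n)" if "i < Suc n" for i
    proof -
      have "i / Suc n \<le> Suc i / Suc n" by (intro divide_right_mono) auto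
      then show ?thesis using that by (simp add: mono_onD[OF rmono])
    qed
    have "(\<integral>\<omega>. iexp (u \<bullet> X n \<omega>) \<partial>M)
       = (\<integral>\<omega>. (\<Prod>i<Suc n. iexp (((i / Suc n) *\<^sub>R u) \<bullet> (Y (r (Suc i / Suc n)) \<omega> - Y (r (i / Suc n)) \<omega>))) \<partial>M)"
      unfolding X_def by (simp only: inner_sum_right of_real_sum sum_distrib_left exp_sum[OF finite_lessThan] inner_scaleR_left inner_scaleR_right)
    also have "\<dots> = (\<Prod>i<Suc n. \<integral>\<omega>. iexp (((i / Suc n) *\<^sub>R u) \<bullet> Y (r (Suc i / Suc n) - r (i / Suc n)) \<omega>) \<partial>M)"
      by (rule levy_increments_char[OF L]) (use ri r0 in auto)
    also have "\<dots> = (\<Prod>i<Suc n. exp (of_real (r (Suc i / Suc n) - r (i / Suc n)) * \<psi> ((i / Suc n) *\<^sub>R u)))"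
    proof (rule prod.cong[OF refl])
      fix i assume "i \<in> {..<Suc n}"
      then have "0 \<le> r (Suc i / Suc n) - r (i / Suc n)" using ri by blast
      then show "(\<integral>\<omega>. iexp (((i / Suc n) *\<^sub>R u) \<bullet> Y (r (Suc i / Suc n) - r (i / Suc n)) \<omega>) \<partial>M)
        = exp (of_real (r (Suc i / Suc n) - r (i / Suc n)) * \<psi> ((i / Suc n) *\<^sub>R u))" by (rule exp)
    qed
    also have "\<dots> = exp (\<Sum>i<Suc n. of_real (r (Suc i / Suc n) - r (i / Suc n)) * \<psi> ((i / Suc n) *\<^sub>R u))"
      by (simp only: exp_sum[OF finite_lessThan])
    also have "(\<Sum>i<Suc n. of_real (r (Suc i / Suc n) - r (i / Suc n)) * \<psi> ((i / Suc n) *\<^sub>R u))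
       = of_real c * (\<Sum>i<Suc n. of_real (F (Suc i / Suc n) - F (i / Suc n)) * \<psi> ((i / Suc n) *\<^sub>R u))"
      unfolding sum_distrib_left
    proof (rule sum.cong[OF refl])
      fix i assume "i \<in> {..<Suc n}"
      then have "r (Suc i / Suc n) = c * F (Suc i / Suc n)" "r (i / Suc n) = c * F (i / Suc n)"
        by (auto simp: r F_def)
      then have "r (Suc i / Suc n) - r (i / Suc n) = c * (F (Suc i / Suc n) - F (i / Suc n))"
        by (simp only: right_diff_distrib)
      then show "of_real (r (Suc i / Suc n) - r (i / Suc n)) * \<psi> ((i / Suc n) *\<^sub>R u) =
          of_real c * (of_real (F (Suc i / Suc n) - F (i / Suc n)) * \<psi> ((i / Suc n) *\<^sub>R u))"
        by (simp only: of_real_mult mult.assoc)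
    qed
    also have "(\<Sum>i<Suc n. of_real (F (Suc i / Suc n) - F (i / Suc n)) * \<psi> ((i / Suc n) *\<^sub>R u))
       = (\<integral>\<omega>. \<psi> (((of_int \<lceil>V \<omega> * Suc n\<rceil> - 1) / Suc n) *\<^sub>R u) \<partial>N)"
      by (rule mean_of_steps[OF N V, of F "\<lambda>x. \<psi> (x *\<^sub>R u)", symmetric]) (simp add: F_def)
    finally show ?thesis .
  qed
  have charZ: "(\<integral>\<omega>. iexp (u \<bullet> Z \<omega>) \<partial>M) = exp (E u)" for u
  proof -
    have "(\<lambda>n. \<integral>\<omega>. iexp (u \<bullet> X n \<omega>) \<partial>M) \<longlonglongrightarrow> (\<integral>\<omega>. iexp (u \<bullet> Z \<omega>) \<partial>M)"
      by (rule integral_dominated_convergence[where w="\<lambda>_. 1"]) (auto intro!: AE_I2 tendsto_intros lim)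
    moreover have "(\<lambda>n. \<integral>\<omega>. \<psi> (((of_int \<lceil>V \<omega> * Suc n\<rceil> - 1) / Suc n) *\<^sub>R u) \<partial>N) \<longlonglongrightarrow> (\<integral>\<omega>. \<psi> (V \<omega> *\<^sub>R u) \<partial>N)"
    proof -
      have "bounded (\<psi> ` cball 0 (norm u))"
        by (intro compact_imp_bounded compact_continuous_image continuous_on_subset[OF psi(1)]) auto
      then obtain B where B: "\<And>v. norm v \<le> norm u \<Longrightarrow> cmod (\<psi> v) \<le> B"
        unfolding bounded_iff by (metis imageI mem_cball_0)
      have D: "0 \<le> (of_int \<lceil>v * Suc n\<rceil> - 1) / Suc n" "(of_int \<lceil>v * Suc n\<rceil> - 1) / Suc n \<le> v"
         "v - 1 / Suc n \<le> (of_int \<lceil>v * Suc n\<rceil> - 1) / Suc n" if "0 < v" for v :: real and n :: nat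
      proof -
        define S where "S = real (Suc n)"
        have S: "S > 0" by (simp add: S_def)
        have "1 \<le> \<lceil>v * S\<rceil>" using mult_pos_pos[OF that S] by linarith
        then have "1 \<le> real_of_int \<lceil>v * S\<rceil>" by linarith
        moreover have "v * S \<le> of_int \<lceil>v * S\<rceil>" "of_int \<lceil>v * S\<rceil> \<le> v * S + 1" by linarith+
        ultimately show "0 \<le> (of_int \<lceil>v * Suc n\<rceil> - 1) / Suc n" "(of_int \<lceil>v * Suc n\<rceil> - 1) / Suc n \<le> v"
          "v - 1 / Suc n \<le> (of_int \<lceil>v * Suc n\<rceil> - 1) / Suc n"
          unfolding S_def[symmetric] using S by (simp_all add: field_simps)
      qed
      show ?thesis
      proof (rule integral_dominated_convergence[where w="\<lambda>_. B"])
        show "AE \<omega> in N. (\<lambda>n. \<psi> (((of_int \<lceil>V \<omega> * Suc n\<rceil> - 1) / Suc n) *\<^sub>R u)) \<longlonglongrightarrow> \<psi> (V \<omega> *\<^sub>R u)"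
          using V(2)
        proof eventually_elim
          case (elim \<omega>)
          have "(\<lambda>n. V \<omega> - 1 / Suc n) \<longlonglongrightarrow> V \<omega> - 0"
            by (intro tendsto_diff tendsto_const LIMSEQ_Suc[OF lim_1_over_n])
          then have lower: "(\<lambda>n. V \<omega> - 1 / Suc n) \<longlonglongrightarrow> V \<omega>" by (simp only: diff_zero)
          have "0 < V \<omega>" using elim by simp
          then have "(\<lambda>n. (of_int \<lceil>V \<omega> * Suc n\<rceil> - 1) / Suc n) \<longlonglongrightarrow> V \<omega>"
            by (intro tendsto_sandwich[OF _ _ lower tendsto_const] always_eventually allI D)
          then show ?case by (intro continuous_on_tendsto_compose[OF psi(1)] tendsto_intros) auto
        qed
        show "AE \<omega> in N. cmod (\<psi> (((of_int \<lceil>V \<omega> * Suc n\<rceil> - 1) / Suc n) *\<^sub>R u)) \<le> B" for n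
          using V(2)
        proof eventually_elim
          case (elim \<omega>)
          have "norm (((of_int \<lceil>V \<omega> * Suc n\<rceil> - 1) / Suc n) *\<^sub>R u) \<le> 1 * norm u"
            unfolding norm_scaleR
          proof (rule mult_right_mono)
            show "\<bar>(of_int \<lceil>V \<omega> * Suc n\<rceil> - 1) / Suc n\<bar> \<le> 1"
              using D(1,2)[of "V \<omega>" n] elim by linarith
          qed simp
          then show ?case by (intro B) simp
        qed
      qed auto
    qed
    then have "(\<lambda>n. \<integral>\<omega>. iexp (u \<bullet> X n \<omega>) \<partial>M) \<longlonglongrightarrow> exp (E u)"
      unfolding charX E_def by (intro tendsto_intros)
    ultimately show ?thesis by (rule LIMSEQ_unique)
  qed
  have law: "random_integral_law 0 1 (\<lambda>t. t) r M Y = distr M borel Z"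
    by (simp add: random_integral_law_def Z_def[abs_def])
  have "continuous_on UNIV E"
    unfolding E_def by (intro continuous_intros exponent_mean_continuous[OF N V psi(1)])
  moreover have "E 0 = 0" by (simp add: E_def psi(2))
  ultimately show ?thesis
    unfolding law has_exponent_def E_def[symmetric]
    using charZ by (auto simp: char_vec_distr prob_space_distr)
qed

lemma infinitely_divisibleI_exponent:
  assumes mu: "has_exponent \<mu> \<psi>"
    and roots: "\<And>n::nat. (1::nat) \<le> n \<Longrightarrow> \<exists>\<rho>. has_exponent \<rho> (\<lambda>u. of_real (1 / n) * \<psi> u)"
  shows "infinitely_divisible \<mu>"
  unfolding infinitely_divisible_def
proof (intro conjI allI impI)
  show "prob_space \<mu>" "sets \<mu> = sets borel" using mu by (auto simp: has_exponent_def)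
  fix n :: nat assume n: "(1::nat) \<le> n"
  obtain \<rho> where rho: "has_exponent \<rho> (\<lambda>u. of_real (1 / n) * \<psi> u)" using roots[OF n] by blast
  then have r: "prob_space \<rho>" "sets \<rho> = sets borel" by (auto simp: has_exponent_def)
  note [measurable_cong] = r(2)
  interpret p: prob_space "\<Pi>\<^sub>M i\<in>{..<n}. \<rho>" by (rule prob_space_PiM) (rule r(1))
  have "\<mu> = distr (\<Pi>\<^sub>M i\<in>{..<n}. \<rho>) borel (\<lambda>x. \<Sum>i<n. x i)"
  proof (rule char_vec_unique)
    show "prob_space (distr (\<Pi>\<^sub>M i\<in>{..<n}. \<rho>) borel (\<lambda>x. \<Sum>i<n. x i))"
      by (rule p.prob_space_distr) simp
    show "char_vec \<mu> u = char_vec (distr (\<Pi>\<^sub>M i\<in>{..<n}. \<rho>) borel (\<lambda>x. \<Sum>i<n. x i)) u" for u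
    proof -
      have "exp (of_real (1 / n) * \<psi> u) ^ n = exp (of_nat n * (of_real (1 / n) * \<psi> u))"
        by (rule exp_of_nat_mult[symmetric])
      also have "of_nat n * (of_real (1 / n) * \<psi> u) = \<psi> u" using n by simp
      finally show ?thesis
        using mu rho by (simp add: char_vec_sum_iid[OF r] has_exponent_def)
    qed
  qed (use mu in \<open>auto simp: has_exponent_def\<close>)
  with r show "\<exists>\<rho>. prob_space \<rho> \<and> sets \<rho> = sets borel \<and> \<mu> = distr (\<Pi>\<^sub>M i\<in>{..<n}. \<rho>) borel (\<lambda>x. \<Sum>i<n. x i)"
    by blast
qed

text \<open>Running the clock \<open>n\<close> times slower divides the exponent by \<open>n\<close>, which yields the \<open>n\<close>-th
  convolution root.\<close>

lemma random_integral_infinitely_divisible: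
  fixes Y :: "real \<Rightarrow> 'w \<Rightarrow> 'a::euclidean_space"
  assumes L: "levy_process M Y"
    and psi: "continuous_on UNIV \<psi>" "\<psi> 0 = 0"
    and exp: "\<And>t u. 0 \<le> t \<Longrightarrow> (\<integral>\<omega>. iexp (u \<bullet> Y t \<omega>) \<partial>M) = exp (of_real t * \<psi> u)"
    and N: "prob_space N" and V: "V \<in> borel_measurable N" "AE \<omega> in N. 0 < V \<omega> \<and> V \<omega> \<le> 1"
    and r: "\<And>t. t \<in> {0..1} \<Longrightarrow> r t = measure N {\<omega> \<in> space N. V \<omega> \<le> t}"
  shows "has_exponent (random_integral_law 0 1 (\<lambda>t. t) r M Y) (\<lambda>u. \<integral>\<omega>. \<psi> (V \<omega> *\<^sub>R u) \<partial>N)"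
    and "infinitely_divisible (random_integral_law 0 1 (\<lambda>t. t) r M Y)"
proof -
  note R = random_integral_exponent[OF L psi exp N V]
  show e: "has_exponent (random_integral_law 0 1 (\<lambda>t. t) r M Y) (\<lambda>u. \<integral>\<omega>. \<psi> (V \<omega> *\<^sub>R u) \<partial>N)"
    using R[of r 1] r by simp
  show "infinitely_divisible (random_integral_law 0 1 (\<lambda>t. t) r M Y)"
  proof (rule infinitely_divisibleI_exponent[OF e])
    fix n :: nat assume "(1::nat) \<le> n"
    show "\<exists>\<rho>. has_exponent \<rho> (\<lambda>u. of_real (1 / n) * (\<integral>\<omega>. \<psi> (V \<omega> *\<^sub>R u) \<partial>N))"
      by (rule exI, rule R[of "\<lambda>t. (1 / n) * measure N {\<omega> \<in> space N. V \<omega> \<le> t}" "1 / n"]) auto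
  qed
qed

lemma indep_var_mean:
  fixes f :: "real \<Rightarrow> real \<Rightarrow> 'b::{banach, second_countable_topology}"
  assumes N: "prob_space N" and ind: "prob_space.indep_var N borel X borel Z"
    and [measurable]: "case_prod f \<in> borel_measurable (borel \<Otimes>\<^sub>M borel)"
    and int: "integrable N (\<lambda>\<omega>. f (X \<omega>) (Z \<omega>))"
  shows "(\<integral>\<omega>. f (X \<omega>) (Z \<omega>) \<partial>N) = (\<integral>\<omega>. (\<integral>\<omega>'. f (X \<omega>) (Z \<omega>') \<partial>N) \<partial>N)"
proof -
  interpret prob_space N by fact
  have XZ: "random_variable borel X" "random_variable borel Z"
    and eq: "distr N borel X \<Otimes>\<^sub>M distr N borel Z = distr N (borel \<Otimes>\<^sub>M borel) (\<lambda>\<omega>. (X \<omega>, Z \<omega>))"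
    using ind by (auto simp: indep_var_distribution_eq)
  note [measurable] = XZ
  interpret X: prob_space "distr N borel X" by (rule prob_space_distr) simp
  interpret Z: prob_space "distr N borel Z" by (rule prob_space_distr) simp
  interpret pair_sigma_finite "distr N borel X" "distr N borel Z" by standard
  have i: "integrable (distr N borel X \<Otimes>\<^sub>M distr N borel Z) (case_prod f)"
    unfolding eq using int by (subst integrable_distr_eq) auto
  have "(\<integral>\<omega>. f (X \<omega>) (Z \<omega>) \<partial>N) = (\<integral>p. case_prod f p \<partial>(distr N borel X \<Otimes>\<^sub>M distr N borel Z))"
    unfolding eq by (subst integral_distr) auto
  also have "\<dots> = (\<integral>x. (\<integral>z. f x z \<partial>distr N borel Z) \<partial>distr N borel X)"
    using integral_fst'[OF i] by simp
  also have "\<dots> = (\<integral>\<omega>. (\<integral>z. f (X \<omega>) z \<partial>distr N borel Z) \<partial>N)"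
    by (subst integral_distr) auto
  also have "\<dots> = (\<integral>\<omega>. (\<integral>\<omega>'. f (X \<omega>) (Z \<omega>') \<partial>N) \<partial>N)"
    by (rule Bochner_Integration.integral_cong[OF refl], subst integral_distr) auto
  finally show ?thesis .
qed

section \<open>An identity for the coefficients\<close>

text \<open>The \<open>q j\<close> below are the Lagrange basis polynomials for the nodes \<open>\<beta> 1, \<dots>, \<beta> n\<close>. They sum to the
  constant 1, since both sides have degree less than \<open>n\<close> and agree at the nodes, and
  \<open>coeff_C \<beta> j n\<close> is the value of \<open>q j\<close> at 0.\<close>

lemma sum_coeff_C:
  assumes n: "n \<ge> 1" and inj: "inj_on \<beta> {1..n}"
  shows "(\<Sum>j=1..n. coeff_C \<beta> j n) = 1"
proof -
  define q where "q j = (\<Prod>k\<in>{1..n} - {j}. [:\<beta> k / (\<beta> k - \<beta> j), - 1 / (\<beta> k - \<beta> j):])" for j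
  have q_node: "poly (q j) (\<beta> i) = (if i = j then 1 else 0)" if "i \<in> {1..n}" "j \<in> {1..n}" for i j
  proof -
    have ne: "\<beta> k \<noteq> \<beta> j" if "k \<in> {1..n} - {j}" for k
      using that inj \<open>j \<in> {1..n}\<close> by (auto dest: inj_onD)
    have eq: "poly (q j) (\<beta> i) = (\<Prod>k\<in>{1..n} - {j}. (\<beta> k - \<beta> i) / (\<beta> k - \<beta> j))"
      unfolding q_def poly_prod by (rule prod.cong) (auto simp: diff_divide_distrib)
    show ?thesis
    proof (cases "i = j")
      case True
      then show ?thesis unfolding eq using ne by (auto intro!: prod.neutral)
    next
      case False
      then have "(\<Prod>k\<in>{1..n} - {j}. (\<beta> k - \<beta> i) / (\<beta> k - \<beta> j)) = 0"
        using that by (intro prod_zero) (auto intro!: bexI[of _ i])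
      then show ?thesis unfolding eq using False by simp
    qed
  qed
  have q_degree: "degree (q j) \<le> n - 1" if "j \<in> {1..n}" for j
  proof -
    have "degree (q j) \<le> (\<Sum>k\<in>{1..n} - {j}. degree [:\<beta> k / (\<beta> k - \<beta> j), - 1 / (\<beta> k - \<beta> j):])"
      unfolding q_def by (rule degree_prod_sum_le[unfolded comp_def]) simp
    also have "\<dots> \<le> (\<Sum>k\<in>{1..n} - {j}. 1)" by (rule sum_mono) simp
    also have "\<dots> = n - 1" using that by simp
    finally show ?thesis .
  qed
  have "(\<Sum>j=1..n. q j) = 1"
  proof (rule poly_eqI_degree)
    show "poly (\<Sum>j=1..n. q j) x = poly 1 x" if x: "x \<in> \<beta> ` {1..n}" for x
    proof -
      obtain i where i: "x = \<beta> i" "i \<in> {1..n}" using x by blast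
      have "poly (\<Sum>j=1..n. q j) x = (\<Sum>j=1..n. if i = j then 1 else 0)"
        unfolding poly_sum i(1) using q_node i(2) by (intro sum.cong) auto
      then show ?thesis using i(2) by simp
    qed
    have card: "card (\<beta> ` {1..n}) = n" using inj by (simp add: card_image)
    have "degree (\<Sum>j=1..n. q j) \<le> n - 1"
      using q_degree by (intro degree_sum_le) auto
    then show "degree (\<Sum>j=1..n. q j) < card (\<beta> ` {1..n})" "degree (1 :: real poly) < card (\<beta> ` {1..n})"
      unfolding card using n by simp_all
  qed
  then have "poly (\<Sum>j=1..n. q j) 0 = 1" by simp
  then show ?thesis by (simp add: poly_sum q_def poly_prod coeff_C_def)
qed

section \<open>Products of powers of independent uniform variables\<close>

definition uniform_product :: "(nat \<Rightarrow> 'u \<Rightarrow> real) \<Rightarrow> (nat \<Rightarrow> real) \<Rightarrow> nat \<Rightarrow> 'u \<Rightarrow> real" where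
  "uniform_product U \<beta> m \<omega> = (\<Prod>i=1..m. U i \<omega> powr (1 / \<beta> i))"

lemma uniform_AE:
  assumes X: "X \<in> borel_measurable N" and d: "distr N borel X = uniform_measure lborel {0..1::real}"
  shows "AE \<omega> in N. 0 < X \<omega> \<and> X \<omega> \<le> 1"
proof -
  have "AE x in lborel. x \<in> {0..1::real} \<longrightarrow> 0 < x \<and> x \<le> 1"
    using AE_lborel_singleton[of "0::real"] by eventually_elim auto
  then have "AE x in distr N borel X. 0 < x \<and> x \<le> 1"
    unfolding d by (subst AE_uniform_measure) auto
  then show ?thesis using X by (subst (asm) AE_distr_iff) auto
qed

lemma uniform_cdf:
  assumes [measurable]: "X \<in> borel_measurable N" and d: "distr N borel X = uniform_measure lborel {0..1::real}"
    and s: "s \<in> {0..1}"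
  shows "measure N {\<omega> \<in> space N. X \<omega> \<le> s} = s"
proof -
  have "measure N {\<omega> \<in> space N. X \<omega> \<le> s} = measure (distr N borel X) {..s}"
    by (subst measure_distr) (auto intro!: arg_cong[where f="measure N"])
  also have "\<dots> = measure lborel ({0..1} \<inter> {..s}) / measure lborel {0..1::real}"
    unfolding d by (rule measure_uniform_measure) auto
  also have "{0..1} \<inter> {..s} = {0..s}" using s by auto
  finally show ?thesis using s by simp
qed

lemma uniform_root_cdf:
  assumes [measurable]: "X \<in> borel_measurable N" and d: "distr N borel X = uniform_measure lborel {0..1::real}"
    and b: "b > 0" and t: "t \<in> {0..1}"
  shows "measure N {\<omega> \<in> space N. X \<omega> powr (1 / b) \<le> t} = t powr b"
proof -
  have "measure N {\<omega> \<in> space N. X \<omega> powr (1 / b) \<le> t} = measure N {\<omega> \<in> space N. X \<omega> \<le> t powr b}"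
  proof (rule measure_eq_AE)
    show "AE \<omega> in N. \<omega> \<in> {\<omega> \<in> space N. X \<omega> powr (1 / b) \<le> t} \<longleftrightarrow> \<omega> \<in> {\<omega> \<in> space N. X \<omega> \<le> t powr b}"
      using uniform_AE[OF assms(1) d]
    proof eventually_elim
      case (elim \<omega>)
      have "X \<omega> \<le> t powr b" if "X \<omega> powr (1 / b) \<le> t"
        using powr_mono2[of b "X \<omega> powr (1 / b)" t] that b elim by (simp add: powr_powr)
      moreover have "X \<omega> powr (1 / b) \<le> t" if "X \<omega> \<le> t powr b"
        using powr_mono2[of "1 / b" "X \<omega>" "t powr b"] that b t elim by (simp add: powr_powr)
      ultimately show ?case by auto
    qed
  qed auto
  also have "\<dots> = t powr b" using t b by (intro uniform_cdf d) (auto simp: powr_le1)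
  finally show ?thesis .
qed

lemma uniform_mean_eq_integral:
  fixes g :: "real \<Rightarrow> real"
  assumes X[measurable]: "X \<in> borel_measurable N" and d: "distr N borel X = uniform_measure lborel {0..1::real}"
    and g[measurable]: "g \<in> borel_measurable borel" and b: "\<And>x. \<bar>g x\<bar> \<le> B"
    and I: "(g has_integral I) {0..1}"
  shows "(\<integral>\<omega>. g (X \<omega>) \<partial>N) = I"
proof -
  have "(\<integral>\<omega>. g (X \<omega>) \<partial>N) = (\<integral>x. g x \<partial>uniform_measure lborel {0..1})"
    unfolding d[symmetric] by (subst integral_distr) auto
  also have "\<dots> = (\<integral>x. g x \<partial>density lborel (\<lambda>x. ennreal (indicator {0..1} x)))"
    by (simp add: uniform_measure_def ennreal_indicator divide_ennreal_def)
  also have "\<dots> = (\<integral>x. indicator {0..1} x *\<^sub>R g x \<partial>lborel)"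
    by (rule integral_density) auto
  also have "\<dots> = (LINT x:{0..1}|lborel. g x)"
    by (simp add: set_lebesgue_integral_def)
  also have "\<dots> = integral {0..1} g"
  proof (rule set_borel_integral_eq_integral(2))
    show "set_integrable lborel {0..1} g"
      unfolding set_integrable_def
      by (rule integrableI_bounded_set[where A="{0..1}" and B=B])
        (use b in \<open>auto simp: indicator_def intro!: order_trans[OF abs_ge_zero b]\<close>)
  qed
  finally show ?thesis using I by (simp add: integral_unique)
qed

text \<open>On the range of integration in the recursion below, the argument of the distribution function
  stays in the interval where the explicit formulas hold.\<close>

lemma scaled_root_bounds:
  fixes t z b :: real
  assumes "0 < t" "t \<le> 1" "b > 0" "t powr b \<le> z"
  shows "0 < z" "0 < t * z powr (- 1 / b)" "t * z powr (- 1 / b) \<le> 1"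
proof -
  show z: "0 < z" using assms by (smt (verit) powr_gt_zero)
  then show "0 < t * z powr (- 1 / b)" using assms by simp
  have "(t powr b) powr (1 / b) \<le> z powr (1 / b)" using assms by (intro powr_mono2) auto
  then have "t \<le> z powr (1 / b)" using assms by (simp add: powr_powr)
  then show "t * z powr (- 1 / b) \<le> 1" using z by (simp add: powr_minus_divide)
qed

definition product_cdf :: "'u measure \<Rightarrow> (nat \<Rightarrow> 'u \<Rightarrow> real) \<Rightarrow> (nat \<Rightarrow> real) \<Rightarrow> nat \<Rightarrow> real \<Rightarrow> real" where
  "product_cdf N U \<beta> k t = measure N {\<omega> \<in> space N. uniform_product U \<beta> k \<omega> \<le> t}"

context
  fixes N :: "'u measure" and U :: "nat \<Rightarrow> 'u \<Rightarrow> real" and m :: nat and \<beta> :: "nat \<Rightarrow> real"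
  assumes indep: "indep_uniforms N U m" and pos: "\<And>i. i \<in> {1..m} \<Longrightarrow> \<beta> i > 0"
begin

lemma uniforms_prob_space: "prob_space N" and uniforms_indep_vars: "prob_space.indep_vars N (\<lambda>_. borel) U {1..m}"
  and uniforms_distr: "i \<in> {1..m} \<Longrightarrow> distr N borel (U i) = uniform_measure lborel {0..1}"
  using indep by (auto simp: indep_uniforms_def)

lemma uniforms_measurable[measurable]: "i \<in> {1..m} \<Longrightarrow> U i \<in> borel_measurable N"
  using uniforms_indep_vars unfolding prob_space.indep_vars_def[OF uniforms_prob_space] by blast

lemma uniform_product_measurable[measurable]: "k \<le> m \<Longrightarrow> uniform_product U \<beta> k \<in> borel_measurable N"
  unfolding uniform_product_def[abs_def] by (intro borel_measurable_prod) (auto intro!: powr_real_measurable)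

lemma uniform_root_AE: "i \<in> {1..m} \<Longrightarrow> AE \<omega> in N. 0 < U i \<omega> powr (1 / \<beta> i) \<and> U i \<omega> powr (1 / \<beta> i) \<le> 1"
proof -
  assume i: "i \<in> {1..m}"
  show ?thesis
    using uniform_AE[OF uniforms_measurable[OF i] uniforms_distr[OF i]]
    by eventually_elim (use pos[OF i] in \<open>simp add: powr_le1\<close>)
qed

lemma uniform_product_Suc: "uniform_product U \<beta> (Suc k) \<omega> = uniform_product U \<beta> k \<omega> * U (Suc k) \<omega> powr (1 / \<beta> (Suc k))"
  by (simp add: uniform_product_def)

lemma uniform_product_AE: "k \<le> m \<Longrightarrow> AE \<omega> in N. 0 < uniform_product U \<beta> k \<omega> \<and> uniform_product U \<beta> k \<omega> \<le> 1"
proof (induction k)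
  case 0
  then show ?case by (simp add: uniform_product_def)
next
  case (Suc k)
  then have "AE \<omega> in N. 0 < uniform_product U \<beta> k \<omega> \<and> uniform_product U \<beta> k \<omega> \<le> 1" by simp
  with uniform_root_AE[of "Suc k"] Suc.prems show ?case
    unfolding uniform_product_Suc by (auto elim!: eventually_elim2 intro!: mult_le_one)
qed

lemma uniform_product_indep:
  assumes "Suc k \<le> m"
  shows "prob_space.indep_var N borel (\<lambda>\<omega>. U (Suc k) \<omega> powr (1 / \<beta> (Suc k))) borel (uniform_product U \<beta> k)"
proof -
  interpret prob_space N by (rule uniforms_prob_space)
  have "indep_vars (\<lambda>_. borel) (\<lambda>i \<omega>. U i \<omega> powr (1 / \<beta> i)) {1..m}"
    by (rule indep_vars_compose2[OF uniforms_indep_vars]) simp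
  then have "indep_vars (\<lambda>_. borel) (\<lambda>i \<omega>. U i \<omega> powr (1 / \<beta> i)) (insert (Suc k) {1..k})"
    by (rule indep_vars_subset) (use assms in auto)
  then have "indep_var borel (\<lambda>\<omega>. U (Suc k) \<omega> powr (1 / \<beta> (Suc k))) borel (\<lambda>\<omega>. \<Prod>i=1..k. U i \<omega> powr (1 / \<beta> i))"
    by (intro indep_vars_prod) auto
  then show ?thesis
    unfolding uniform_product_def[abs_def] .
qed

section \<open>The exponent of the composed mappings\<close>

text \<open>The induction carries infinite divisibility along, since only then is there a process for the
  next mapping. Its exponent is known from its value at time 1 by uniqueness of exponents; averaging it
  over the new factor and using independence gives the mean over the longer product.\<close>

lemma J_comp_exponent:
  fixes P :: "'a::euclidean_space measure \<Rightarrow> 'w measure"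
  assumes fam: "levy_family P Y" and nu: "infinitely_divisible \<nu>" "has_exponent \<nu> \<psi>" and k: "k \<le> m"
  shows "infinitely_divisible (J_comp P Y \<beta> k \<nu>) \<and>
    has_exponent (J_comp P Y \<beta> k \<nu>) (\<lambda>u. \<integral>\<omega>. \<psi> (uniform_product U \<beta> k \<omega> *\<^sub>R u) \<partial>N)"
  using k
proof (induction k)
  case 0
  interpret prob_space N by (rule uniforms_prob_space)
  show ?case using nu by (simp add: uniform_product_def prob_space)
next
  case (Suc k)
  interpret prob_space N by (rule uniforms_prob_space)
  let ?\<mu> = "J_comp P Y \<beta> k \<nu>" and ?b = "\<beta> (Suc k)"
  let ?V = "uniform_product U \<beta> k" and ?W = "\<lambda>\<omega>. U (Suc k) \<omega> powr (1 / \<beta> (Suc k))"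
  have k: "Suc k \<in> {1..m}" using Suc.prems by simp
  have W[measurable]: "?W \<in> borel_measurable N" using k by (intro powr_real_measurable) auto
  have V[measurable]: "?V \<in> borel_measurable N" using Suc.prems by simp
  have psi: "continuous_on UNIV \<psi>" using nu(2) by (simp add: has_exponent_def)
  have [measurable]: "\<psi> \<in> borel_measurable borel" using psi by (rule borel_measurable_continuous_onI)
  have IH: "infinitely_divisible ?\<mu>" "has_exponent ?\<mu> (\<lambda>u. \<integral>\<omega>. \<psi> (?V \<omega> *\<^sub>R u) \<partial>N)"
    using Suc by auto
  have L: "levy_process (P ?\<mu>) (Y ?\<mu>)" "distr (P ?\<mu>) borel (Y ?\<mu> 1) = ?\<mu>"
    using fam IH(1) by (auto simp: levy_family_def)
  obtain \<psi>' where psi': "has_exponent (distr (P ?\<mu>) borel (Y ?\<mu> 1)) \<psi>'"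
    "\<And>t u. 0 \<le> t \<Longrightarrow> (\<integral>\<omega>. iexp (u \<bullet> Y ?\<mu> t \<omega>) \<partial>P ?\<mu>) = exp (of_real t * \<psi>' u)"
    using levy_process_exponent[OF L(1)] by blast
  have eq: "\<psi>' = (\<lambda>u. \<integral>\<omega>. \<psi> (?V \<omega> *\<^sub>R u) \<partial>N)"
    using has_exponent_unique[OF psi'(1)[unfolded L(2)] IH(2)] .
  have J: "J_comp P Y \<beta> (Suc k) \<nu> = random_integral_law 0 1 (\<lambda>t. t) (\<lambda>t. t powr ?b) (P ?\<mu>) (Y ?\<mu>)"
    using J_map_eq_time_change[of P ?\<mu> Y ?b, OF L(1) pos[OF k]] by simp
  have psi'c: "continuous_on UNIV \<psi>'" "\<psi>' 0 = 0" using psi'(1) by (auto simp: has_exponent_def)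
  note R = random_integral_infinitely_divisible[OF L(1) psi'c psi'(2) uniforms_prob_space W uniform_root_AE[OF k], of "\<lambda>t. t powr ?b"]
  have cdf: "t powr ?b = measure N {\<omega> \<in> space N. ?W \<omega> \<le> t}" if "t \<in> {0..1}" for t
    using uniform_root_cdf[OF uniforms_measurable[OF k] uniforms_distr[OF k] pos[OF k] that] by simp
  have "(\<integral>\<omega>. \<psi>' (?W \<omega> *\<^sub>R u) \<partial>N) = (\<integral>\<omega>. \<psi> (uniform_product U \<beta> (Suc k) \<omega> *\<^sub>R u) \<partial>N)" for u
  proof -
    have "bounded (\<psi> ` cball 0 (norm u))"
      by (intro compact_imp_bounded compact_continuous_image continuous_on_subset[OF psi]) auto
    then obtain B where B: "\<And>v. norm v \<le> norm u \<Longrightarrow> cmod (\<psi> v) \<le> B"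
      unfolding bounded_iff by (metis imageI mem_cball_0)
    have "AE \<omega> in N. cmod (\<psi> ((?V \<omega> * ?W \<omega>) *\<^sub>R u)) \<le> B"
      using uniform_product_AE[OF Suc.prems] unfolding uniform_product_Suc
    proof eventually_elim
      case (elim \<omega>)
      then have "norm ((?V \<omega> * ?W \<omega>) *\<^sub>R u) \<le> 1 * norm u"
        unfolding norm_scaleR by (intro mult_right_mono) auto
      then show ?case by (intro B) simp
    qed
    then have "integrable N (\<lambda>\<omega>. \<psi> ((?V \<omega> * ?W \<omega>) *\<^sub>R u))"
      by (intro integrable_const_bound[where B=B]) auto
    then show ?thesis
      unfolding eq uniform_product_Suc
      by (subst indep_var_mean[OF uniforms_prob_space uniform_product_indep[OF Suc.prems], of "\<lambda>x z. \<psi> ((z * x) *\<^sub>R u)"]) (auto)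
  qed
  with R cdf show ?case unfolding J by simp
qed

text \<open>The value 0 prescribed for the time change at 0 is consistent with the distribution function, as
  the product is almost surely positive.\<close>

lemma time_change_eq:
  assumes "t \<in> {0..1}"
  shows "time_change N U \<beta> m t = measure N {\<omega> \<in> space N. uniform_product U \<beta> m \<omega> \<le> t}"
proof (cases "t = 0")
  case True
  have "measure N {\<omega> \<in> space N. uniform_product U \<beta> m \<omega> \<le> t} = measure N {}"
    using uniform_product_AE[of m] True by (intro measure_eq_AE) (auto elim!: eventually_mono)
  then show ?thesis using True by (simp add: time_change_def)
qed (simp add: time_change_def uniform_product_def)

lemma J_comp_eq_random_integral:
  fixes P :: "'a::euclidean_space measure \<Rightarrow> 'w measure"
  assumes fam: "levy_family P Y" and nu: "infinitely_divisible \<nu>"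
  shows "J_comp P Y \<beta> m \<nu> = random_integral_law 0 1 (\<lambda>t. t) (time_change N U \<beta> m) (P \<nu>) (Y \<nu>)"
proof -
  have L: "levy_process (P \<nu>) (Y \<nu>)" "distr (P \<nu>) borel (Y \<nu> 1) = \<nu>"
    using fam nu by (auto simp: levy_family_def)
  obtain \<psi> where psi: "has_exponent \<nu> \<psi>"
    "\<And>t u. 0 \<le> t \<Longrightarrow> (\<integral>\<omega>. iexp (u \<bullet> Y \<nu> t \<omega>) \<partial>P \<nu>) = exp (of_real t * \<psi> u)"
    using levy_process_exponent[OF L(1)] unfolding L(2) by blast
  then have c: "continuous_on UNIV \<psi>" "\<psi> 0 = 0" by (auto simp: has_exponent_def)
  show ?thesis
  proof (rule has_exponent_determines)
    show "has_exponent (J_comp P Y \<beta> m \<nu>) (\<lambda>u. \<integral>\<omega>. \<psi> (uniform_product U \<beta> m \<omega> *\<^sub>R u) \<partial>N)"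
      using J_comp_exponent[OF fam nu psi(1), of m] by simp
    show "has_exponent (random_integral_law 0 1 (\<lambda>t. t) (time_change N U \<beta> m) (P \<nu>) (Y \<nu>))
       (\<lambda>u. \<integral>\<omega>. \<psi> (uniform_product U \<beta> m \<omega> *\<^sub>R u) \<partial>N)"
      by (rule random_integral_infinitely_divisible(1)[OF L(1) c psi(2) uniforms_prob_space]) (simp_all only: time_change_eq uniform_product_AE[OF order_refl] uniform_product_measurable[OF order_refl])
  qed
qed

section \<open>Explicit distribution functions\<close>

lemma product_cdf_1:
  assumes "1 \<le> m" "t \<in> {0..1}"
  shows "product_cdf N U \<beta> 1 t = t powr \<beta> 1"
  using uniform_root_cdf[of "U 1" N "\<beta> 1" t] uniforms_measurable[of 1] uniforms_distr[of 1] pos[of 1] assms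
  by (simp add: product_cdf_def uniform_product_def)

text \<open>Conditioning on \<open>U (k + 1) = z\<close>: for \<open>z < t powr b\<close> the last factor alone is below \<open>t\<close> and
  the conditional probability is 1; the other \<open>z\<close> contribute the integral of the previous
  distribution function, evaluated through an antiderivative \<open>G\<close>.\<close>

lemma product_cdf_Suc:
  assumes k: "Suc k \<le> m" and t: "0 < t" "t \<le> 1"
    and G: "\<And>z. t powr \<beta> (Suc k) \<le> z \<Longrightarrow> z \<le> 1 \<Longrightarrow>
      (G has_real_derivative product_cdf N U \<beta> k (t * z powr (- 1 / \<beta> (Suc k)))) (at z)"
  shows "product_cdf N U \<beta> (Suc k) t = t powr \<beta> (Suc k) + G 1 - G (t powr \<beta> (Suc k))"
proof -
  interpret prob_space N by (rule uniforms_prob_space)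
  let ?b = "\<beta> (Suc k)" and ?V = "uniform_product U \<beta> k" and ?W = "\<lambda>\<omega>. U (Suc k) \<omega> powr (1 / \<beta> (Suc k))"
  have kk: "Suc k \<in> {1..m}" using k by simp
  have b: "?b > 0" using pos kk by simp
  note AEs = uniform_product_AE uniform_root_AE[OF kk]
  have U[measurable]: "U (Suc k) \<in> borel_measurable N" using uniforms_measurable[OF kk] .
  have V[measurable]: "?V \<in> borel_measurable N" using uniform_product_measurable[of k] k by simp
  have V1[measurable]: "uniform_product U \<beta> (Suc k) \<in> borel_measurable N"
    using uniform_product_measurable[OF k] .
  have mono: "mono (product_cdf N U \<beta> k)"
    unfolding product_cdf_def by (intro monoI finite_measure_mono) auto
  then have [measurable]: "product_cdf N U \<beta> k \<in> borel_measurable borel" by (rule borel_measurable_mono)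
  define g where "g z = product_cdf N U \<beta> k (t / z powr (1 / ?b))" for z
  have gm: "g \<in> borel_measurable borel" unfolding g_def by measurable
  have gb: "\<bar>g z\<bar> \<le> 1" for z by (simp add: g_def product_cdf_def)
  have "product_cdf N U \<beta> (Suc k) t = (\<integral>\<omega>. indicator {..t} (?V \<omega> * ?W \<omega>) \<partial>N)"
  proof -
    have "product_cdf N U \<beta> (Suc k) t = (\<integral>\<omega>. indicator {\<omega> \<in> space N. uniform_product U \<beta> (Suc k) \<omega> \<le> t} \<omega> \<partial>N)"
      by (simp add: product_cdf_def Int_def conj_ac cong: conj_cong)
    also have "\<dots> = (\<integral>\<omega>. indicator {..t} (?V \<omega> * ?W \<omega>) \<partial>N)"
      by (rule Bochner_Integration.integral_cong) (auto simp: uniform_product_Suc indicator_def)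
    finally show ?thesis .
  qed
  also have "\<dots> = (\<integral>\<omega>. (\<integral>\<omega>'. indicator {..t} (?V \<omega>' * ?W \<omega>) \<partial>N) \<partial>N)"
    by (rule indep_var_mean[OF uniforms_prob_space uniform_product_indep[OF k], of "\<lambda>x z. indicator {..t} (z * x)"])
      (auto intro!: integrable_const_bound[where B=1])
  also have "\<dots> = (\<integral>\<omega>. g (U (Suc k) \<omega>) \<partial>N)"
  proof (rule integral_cong_AE)
    show "AE \<omega> in N. (\<integral>\<omega>'. indicator {..t} (?V \<omega>' * ?W \<omega>) \<partial>N) = g (U (Suc k) \<omega>)"
      using AEs(2)
    proof eventually_elim
      case (elim \<omega>)
      have "(\<integral>\<omega>'. indicator {..t} (?V \<omega>' * ?W \<omega>) \<partial>N) = (\<integral>\<omega>'. indicator {\<omega>' \<in> space N. ?V \<omega>' \<le> t / ?W \<omega>} \<omega>' \<partial>N)"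
        by (rule Bochner_Integration.integral_cong) (use elim in \<open>auto simp: indicator_def field_simps\<close>)
      also have "\<dots> = product_cdf N U \<beta> k (t / ?W \<omega>)"
        by (simp add: product_cdf_def Int_def conj_ac cong: conj_cong)
      finally show ?case by (simp add: g_def)
    qed
    show "(\<lambda>\<omega>. g (U (Suc k) \<omega>)) \<in> borel_measurable N" using gm U by measurable
  qed measurable
  also have "\<dots> = t powr ?b + (G 1 - G (t powr ?b))"
  proof (rule uniform_mean_eq_integral[OF U uniforms_distr[OF kk] gm gb])
    let ?c = "t powr ?b"
    have c: "0 < ?c" "?c \<le> 1" using t b by (auto simp: powr_le1)
    have 1: "(g has_integral ?c) {0..?c}"
      \<comment> \<open>At \<open>z = 0\<close> the quotient \<open>t / 0 = 0\<close> gives the wrong value of \<open>g\<close>.\<close>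
    proof (rule has_integral_spike_finite[of "{0}"])
      show "((\<lambda>_. 1) has_integral ?c) {0..?c}" using has_integral_const_real[of "1::real" 0 ?c] c by simp
      fix z assume z: "z \<in> {0..?c} - {0}"
      then have "z powr (1 / ?b) \<le> ?c powr (1 / ?b)" using b by (intro powr_mono2) auto
      also have "\<dots> = t" using t b by (simp add: powr_powr)
      finally have "1 \<le> t / z powr (1 / ?b)" using z by simp
      have "g z = prob (space N)"
        unfolding g_def product_cdf_def
      proof (rule measure_eq_AE)
        show "AE \<omega> in N. \<omega> \<in> {\<omega> \<in> space N. ?V \<omega> \<le> t / z powr (1 / ?b)} \<longleftrightarrow> \<omega> \<in> space N"
          using uniform_product_AE[OF Suc_leD[OF k]]
        proof eventually_elim
          case (elim \<omega>)
          then have "?V \<omega> \<le> t / z powr (1 / ?b)" using \<open>1 \<le> t / z powr (1 / ?b)\<close> by linarith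
          then show ?case by simp
        qed
      qed auto
      then show "g z = 1" by (simp add: prob_space)
    qed auto
    have "((\<lambda>z. product_cdf N U \<beta> k (t * z powr (- 1 / ?b))) has_integral (G 1 - G ?c)) {?c..1}"
      using c G by (intro fundamental_theorem_of_calculus)
        (auto simp: has_real_derivative_iff_has_vector_derivative[symmetric] intro: DERIV_subset)
    then have 2: "(g has_integral (G 1 - G ?c)) {?c..1}"
      by (rule has_integral_eq[rotated]) (auto simp: g_def powr_minus_divide)
    show "(g has_integral ?c + (G 1 - G ?c)) {0..1}"
      using has_integral_combine[OF _ _ 1 2] c by simp
  qed
  finally show ?thesis by simp
qed

text \<open>The induction starts at one factor: the empty product has distribution function 1 at \<open>t = 1\<close>,
  where the empty sum is 0.\<close>

lemma product_cdf_distinct: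
  assumes inj: "inj_on \<beta> {1..m}" and k: "1 \<le> k" "k \<le> m" and t: "0 < t" "t \<le> 1"
  shows "product_cdf N U \<beta> k t = (\<Sum>j=1..k. coeff_C \<beta> j k * t powr \<beta> j)"
  using k t
proof (induction k arbitrary: t rule: nat_induct_at_least)
  case base
  have "{Suc 0..Suc 0} - {Suc 0} = {}" by auto
  then show ?case using product_cdf_1[of t] base by (simp add: coeff_C_def)
next
  case (Suc k)
  let ?b = "\<beta> (Suc k)"
  have b: "?b > 0" using pos Suc.prems by simp
  have ne: "\<beta> j \<noteq> ?b" and bj: "\<beta> j > 0" if "j \<in> {1..k}" for j
    using that inj pos Suc.prems by (auto dest: inj_onD)
  have C: "coeff_C \<beta> j (Suc k) = coeff_C \<beta> j k * (?b / (?b - \<beta> j))" if "j \<in> {1..k}" for j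
  proof -
    have "{1..Suc k} - {j} = insert (Suc k) ({1..k} - {j})" using that by auto
    then show ?thesis by (simp add: coeff_C_def)
  qed
  define G where "G z = (\<Sum>j=1..k. coeff_C \<beta> j (Suc k) * t powr \<beta> j * z powr (1 - \<beta> j / ?b))" for z
  have "product_cdf N U \<beta> (Suc k) t = t powr ?b + G 1 - G (t powr ?b)"
  proof (rule product_cdf_Suc)
    fix z assume z: "t powr ?b \<le> z" "z \<le> 1"
    note s = scaled_root_bounds[OF Suc.prems(2,3) b z(1)]
    have "(G has_real_derivative (\<Sum>j=1..k. coeff_C \<beta> j (Suc k) * t powr \<beta> j * ((1 - \<beta> j / ?b) * z powr (1 - \<beta> j / ?b - 1)))) (at z)"
      unfolding G_def by (intro DERIV_sum DERIV_cmult has_real_derivative_powr s(1))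
    also have "(\<Sum>j=1..k. coeff_C \<beta> j (Suc k) * t powr \<beta> j * ((1 - \<beta> j / ?b) * z powr (1 - \<beta> j / ?b - 1)))
      = (\<Sum>j=1..k. coeff_C \<beta> j k * (t * z powr (- 1 / ?b)) powr \<beta> j)"
    proof (rule sum.cong[OF refl])
      fix j assume j: "j \<in> {1..k}"
      have "coeff_C \<beta> j (Suc k) * (1 - \<beta> j / ?b) = coeff_C \<beta> j k"
        using ne[OF j] b by (simp add: C[OF j] field_simps)
      moreover have "(t * z powr (- 1 / ?b)) powr \<beta> j = t powr \<beta> j * z powr (1 - \<beta> j / ?b - 1)"
        using s Suc.prems by (simp add: powr_mult powr_powr)
      ultimately show "coeff_C \<beta> j (Suc k) * t powr \<beta> j * ((1 - \<beta> j / ?b) * z powr (1 - \<beta> j / ?b - 1))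
          = coeff_C \<beta> j k * (t * z powr (- 1 / ?b)) powr \<beta> j"
        by (simp add: mult_ac)
    qed
    also have "\<dots> = product_cdf N U \<beta> k (t * z powr (- 1 / ?b))"
      using Suc.IH[of "t * z powr (- 1 / ?b)"] Suc.prems s by simp
    finally show "(G has_real_derivative product_cdf N U \<beta> k (t * z powr (- 1 / ?b))) (at z)" .
  qed (use Suc.prems in auto)
  also have "G 1 = (\<Sum>j=1..k. coeff_C \<beta> j (Suc k) * t powr \<beta> j)"
    by (simp add: G_def)
  also have "G (t powr ?b) = (\<Sum>j=1..k. coeff_C \<beta> j (Suc k)) * t powr ?b"
    unfolding G_def sum_distrib_right
  proof (rule sum.cong[OF refl])
    fix j assume j: "j \<in> {1..k}"
    have "?b * (1 - \<beta> j / ?b) = ?b - \<beta> j" using b by (simp add: field_simps)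
    then have "t powr \<beta> j * (t powr ?b) powr (1 - \<beta> j / ?b) = t powr ?b"
      by (simp add: powr_powr powr_add[symmetric])
    then show "coeff_C \<beta> j (Suc k) * t powr \<beta> j * (t powr ?b) powr (1 - \<beta> j / ?b) = coeff_C \<beta> j (Suc k) * t powr ?b"
      by (simp add: mult.assoc)
  qed
  also have "(\<Sum>j=1..k. coeff_C \<beta> j (Suc k)) = 1 - coeff_C \<beta> (Suc k) (Suc k)"
    using sum_coeff_C[of "Suc k" \<beta>] inj_on_subset[OF inj, of "{1..Suc k}"] Suc.prems by simp
  finally show ?case by (simp add: algebra_simps)
qed

text \<open>Passing from \<open>t\<close> to \<open>t z powr (-1/\<alpha>)\<close> turns \<open>-\<alpha> ln t\<close> into \<open>L z = -\<alpha> ln t + ln z\<close> and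
  \<open>t powr \<alpha>\<close> into \<open>t powr \<alpha> / z\<close>, so that each summand integrates to the next power of \<open>L\<close>,
  which vanishes at the lower end \<open>z = t powr \<alpha>\<close>.\<close>

lemma product_cdf_equal:
  assumes a: "\<alpha> > 0" "\<forall>i\<in>{1..m}. \<beta> i = \<alpha>" and k: "1 \<le> k" "k \<le> m" and t: "0 < t" "t \<le> 1"
  shows "product_cdf N U \<beta> k t = t powr \<alpha> * (\<Sum>j<k. (- \<alpha> * ln t) ^ j / fact j)"
  using k t
proof (induction k arbitrary: t rule: nat_induct_at_least)
  case base
  then show ?case using product_cdf_1[of t] a by simp
next
  case (Suc k)
  have bk: "\<beta> (Suc k) = \<alpha>" using a Suc.prems by simp
  define L where "L z = - \<alpha> * ln t + ln z" for z
  define G where "G z = t powr \<alpha> * (\<Sum>j<k. L z ^ Suc j / fact (Suc j))" for z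
  have "product_cdf N U \<beta> (Suc k) t = t powr \<beta> (Suc k) + G 1 - G (t powr \<beta> (Suc k))"
  proof (rule product_cdf_Suc)
    fix z assume z: "t powr \<beta> (Suc k) \<le> z" "z \<le> 1"
    note s = scaled_root_bounds[OF Suc.prems(2,3) a(1) z(1)[unfolded bk]]
    have L: "(L has_real_derivative 1 / z) (at z)"
      unfolding L_def using s(1) by (auto intro!: derivative_eq_intros)
    have "((\<lambda>z. L z ^ Suc j / fact (Suc j)) has_real_derivative L z ^ j / fact j / z) (at z)" for j
    proof -
      have "((\<lambda>z. L z ^ Suc j / fact (Suc j)) has_real_derivative (real (Suc j) * (1 / z * L z ^ j)) / fact (Suc j)) (at z)"
        using DERIV_power[OF L, of "Suc j"] by (intro DERIV_cdivide) simp
      moreover have "fact (Suc j) = real (Suc j) * fact j" by simp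
      then have "(real (Suc j) * (1 / z * L z ^ j)) / fact (Suc j) = L z ^ j / fact j / z"
        by (simp del: of_nat_Suc fact_Suc)
      ultimately show ?thesis by (simp only:)
    qed
    then have "(G has_real_derivative t powr \<alpha> * (\<Sum>j<k. L z ^ j / fact j / z)) (at z)"
      unfolding G_def by (intro DERIV_cmult DERIV_sum)
    also have "t powr \<alpha> * (\<Sum>j<k. L z ^ j / fact j / z) = (t powr \<alpha> / z) * (\<Sum>j<k. L z ^ j / fact j)"
      by (simp only: sum_divide_distrib[symmetric] times_divide_eq_left times_divide_eq_right)
    also have "t powr \<alpha> / z = (t * z powr (- 1 / \<alpha>)) powr \<alpha>"
    proof -
      have "(z powr (- 1 / \<alpha>)) powr \<alpha> = z powr - 1" using a(1) by (simp add: powr_powr)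
      also have "\<dots> = 1 / z" using s(1) by (simp add: powr_minus_divide)
      finally show ?thesis using Suc.prems s(1) by (simp add: powr_mult)
    qed
    also have "L z = - \<alpha> * ln (t * z powr (- 1 / \<alpha>))"
      using s a(1) Suc.prems by (simp add: L_def ln_mult ln_powr algebra_simps)
    also have "(t * z powr (- 1 / \<alpha>)) powr \<alpha> * (\<Sum>j<k. (- \<alpha> * ln (t * z powr (- 1 / \<alpha>))) ^ j / fact j)
        = product_cdf N U \<beta> k (t * z powr (- 1 / \<beta> (Suc k)))"
      using Suc.IH[of "t * z powr (- 1 / \<alpha>)"] Suc.prems s by (simp add: bk)
    finally show "(G has_real_derivative product_cdf N U \<beta> k (t * z powr (- 1 / \<beta> (Suc k)))) (at z)" .
  qed (use Suc.prems in auto)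
  also have "G (t powr \<beta> (Suc k)) = 0"
    using Suc.prems by (simp add: G_def L_def bk ln_powr)
  also have "G 1 = t powr \<alpha> * (\<Sum>j<k. (- \<alpha> * ln t) ^ Suc j / fact (Suc j))"
    by (simp add: G_def L_def)
  finally show ?case
    unfolding bk by (simp only: sum.lessThan_Suc_shift distrib_left) simp
qed

end

section \<open>Iterated random integrals\<close>

theorem theorem1:
  fixes P :: "'a::euclidean_space measure \<Rightarrow> 'w measure"
    and Y :: "'a measure \<Rightarrow> real \<Rightarrow> 'w \<Rightarrow> 'a"
    and \<nu> :: "'a measure"
    and N :: "'u measure" and U :: "nat \<Rightarrow> 'u \<Rightarrow> real"
    and m :: nat and \<beta> :: "nat \<Rightarrow> real"
  assumes "m \<ge> 1"
    and "\<And>i. i \<in> {1..m} \<Longrightarrow> \<beta> i > 0"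
    and "indep_uniforms N U m"
  shows
    "(levy_family P Y \<and> infinitely_divisible \<nu> \<longrightarrow>
        J_comp P Y \<beta> m \<nu> =
          random_integral_law 0 1 (\<lambda>t. t) (time_change N U \<beta> m) (P \<nu>) (Y \<nu>)) \<and>
     (inj_on \<beta> {1..m} \<longrightarrow>
        (\<forall>t. 0 < t \<and> t \<le> 1 \<longrightarrow>
          time_change N U \<beta> m t = (\<Sum>j=1..m. coeff_C \<beta> j m * t powr \<beta> j)) \<and>
        (\<Sum>j=1..m. coeff_C \<beta> j m) = 1) \<and>
     (\<forall>\<alpha>>0. (\<forall>i\<in>{1..m}. \<beta> i = \<alpha>) \<longrightarrow>
        (\<forall>t. 0 < t \<and> t \<le> 1 \<longrightarrow>
          time_change N U \<beta> m t = t powr \<alpha> * (\<Sum>j=0..m-1. (- \<alpha> * ln t) ^ j / fact j)))"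
proof (intro conjI impI allI; (elim conjE)?)
  have r: "time_change N U \<beta> m t = product_cdf N U \<beta> m t" if "0 < t" "t \<le> 1" for t
    using time_change_eq[OF assms(3,2), where t=t] that by (simp add: product_cdf_def)
  show "J_comp P Y \<beta> m \<nu> = random_integral_law 0 1 (\<lambda>t. t) (time_change N U \<beta> m) (P \<nu>) (Y \<nu>)"
    if "levy_family P Y" "infinitely_divisible \<nu>"
    using J_comp_eq_random_integral[OF assms(3,2) that] by simp
  show "time_change N U \<beta> m t = (\<Sum>j=1..m. coeff_C \<beta> j m * t powr \<beta> j)"
    if "inj_on \<beta> {1..m}" "0 < t" "t \<le> 1" for t
    using product_cdf_distinct[OF assms(3,2) that(1) assms(1) order_refl that(2,3)] r[OF that(2,3)] by simp
  show "(\<Sum>j=1..m. coeff_C \<beta> j m) = 1" if "inj_on \<beta> {1..m}"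
    by (rule sum_coeff_C[OF assms(1) that])
  have "{0..m - 1} = {..<m}" using assms(1) by auto
  then show "time_change N U \<beta> m t = t powr \<alpha> * (\<Sum>j=0..m-1. (- \<alpha> * ln t) ^ j / fact j)"
    if "\<alpha> > 0" "\<forall>i\<in>{1..m}. \<beta> i = \<alpha>" "0 < t" "t \<le> 1" for \<alpha> t
    using product_cdf_equal[OF assms(3,2) that(1,2) assms(1) order_refl that(3,4)] r[OF that(3,4)] by simp
qed

end
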